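(* For every integer $n\ge0$, every $i\in\{0,2\}$ and every $j\in\{0,1,2,3,4\}$, the number of partitions $\pi$ of $5n+4$ with $\mathrm{srank}(\pi)\equiv i\pmod4$ and $c_5(\pi)\equiv j\pmod 5$ equals $\tfrac15 p_i(5n+4)$.
   Context: For a partition $\pi$, $\pi'$ is its conjugate, $\mathcal O(\pi)$ the number of odd parts, $\mathrm{srank}(\pi)=\mathcal O(\pi)-\mathcal O(\pi')$, and $p_i(n)$ ($i=0,2$) the number of partitions of $n$ with $\mathrm{srank}\equiv i\pmod4$. A $t$-core is a partition with no rim hook (border strip) of length $t$; the $t$-core of $\pi$ is the $t$-core obtained by successively removing rim hooks of length $t$ from $\pi$ as long as possible. In the Young diagram, the cell in row $a$ and column $b$ is labelled by the residue of $b-a$ modulo $t$. For a $t$-core $\kappa$, let $r_i$ ($0\le i\le t-1$) be the number of cells of $\kappa$ labelled $i$; its $n$-vector is $(n_0,\dots,n_{t-1})=(r_0-r_1,r_1-r_2,\dots,r_{t-2}-r_{t-1},r_{t-1}-r_0)$. 5-core crank: for a partition $\pi$ with $|\pi|\equiv4\pmod5$, let $(n_0,\dots,n_4)$ be the $n$-vector of the 5-core of $\pi$; then $c_5(\pi)$ is defined modulo $5$ by $c_5(\pi)\equiv 2(1+n_0-n_1-n_2+n_3)\pmod 5$. *)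

theory Defs
  imports Complex_Main
begin

text \<open>Partitions are represented as lists of positive naturals in nonincreasing order.\<close>

definition is_partition :: "nat list \<Rightarrow> bool" where
  "is_partition p \<longleftrightarrow> sorted_wrt (\<ge>) p \<and> 0 \<notin> set p"

definition partitions :: "nat \<Rightarrow> nat list set" where
  "partitions m = {p. is_partition p \<and> sum_list p = m}"

text \<open>Conjugate partition: the k-th part (k = 1 .. largest part) counts parts that are at least k.\<close>
definition conj_part :: "nat list \<Rightarrow> nat list" where
  "conj_part p = map (\<lambda>k. length (filter (\<lambda>x. k < x) p))
                     [0..<(if p = [] then 0 else hd p)]"

definition num_odd :: "nat list \<Rightarrow> nat" where
  "num_odd p = length (filter odd p)"

definition srank :: "nat list \<Rightarrow> int" where
  "srank p = int (num_odd p) - int (num_odd (conj_part p))"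

definition p_srank :: "int \<Rightarrow> nat \<Rightarrow> nat" where
  "p_srank i m = card {p \<in> partitions m. srank p mod 4 = i}"

text \<open>Young diagram, 0-indexed: cell (a,b) lies in row a, column b.\<close>
definition diagram :: "nat list \<Rightarrow> (nat \<times> nat) set" where
  "diagram p = {(a, b). a < length p \<and> b < p ! a}"

definition cell_adj :: "nat \<times> nat \<Rightarrow> nat \<times> nat \<Rightarrow> bool" where
  "cell_adj u v \<longleftrightarrow>
     (fst u = fst v \<and> (snd u = snd v + 1 \<or> snd v = snd u + 1)) \<or>
     (snd u = snd v \<and> (fst u = fst v + 1 \<or> fst v = fst u + 1))"

definition cells_connected :: "(nat \<times> nat) set \<Rightarrow> bool" where
  "cells_connected S \<longleftrightarrow>
     (\<forall>x\<in>S. \<forall>y\<in>S. (x, y) \<in> {(u, v). u \<in> S \<and> v \<in> S \<and> cell_adj u v}\<^sup>*)"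

definition no_2x2 :: "(nat \<times> nat) set \<Rightarrow> bool" where
  "no_2x2 S \<longleftrightarrow> \<not> (\<exists>a b. {(a, b), (a + 1, b), (a, b + 1), (a + 1, b + 1)} \<subseteq> S)"

text \<open>q is obtained from p by removing a rim hook (border strip) of length t:
  the skew shape p/q is a connected set of t cells containing no 2x2 square.\<close>
definition remove_hook :: "nat \<Rightarrow> nat list \<Rightarrow> nat list \<Rightarrow> bool" where
  "remove_hook t p q \<longleftrightarrow>
     is_partition p \<and> is_partition q \<and> diagram q \<subseteq> diagram p \<and>
     card (diagram p - diagram q) = t \<and>
     cells_connected (diagram p - diagram q) \<and> no_2x2 (diagram p - diagram q)"

definition is_core :: "nat \<Rightarrow> nat list \<Rightarrow> bool" where
  "is_core t k \<longleftrightarrow> is_partition k \<and> \<not> (\<exists>q. remove_hook t k q)"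

text \<open>The t-core: the t-core reached by successively removing rim hooks of length t.\<close>
definition core :: "nat \<Rightarrow> nat list \<Rightarrow> nat list" where
  "core t p = (THE k. is_core t k \<and> (remove_hook t)\<^sup>*\<^sup>* p k)"

definition res_count :: "nat \<Rightarrow> nat list \<Rightarrow> nat \<Rightarrow> int" where
  "res_count t k i = int (card {(a, b) \<in> diagram k. (int b - int a) mod int t = int i})"

text \<open>n-vector: n_i = r_i - r_{i+1}, indices mod t.\<close>
definition nvec :: "nat \<Rightarrow> nat list \<Rightarrow> nat \<Rightarrow> int" where
  "nvec t k i = res_count t k i - res_count t k ((i + 1) mod t)"

definition crank5 :: "nat list \<Rightarrow> int" where
  "crank5 p = (let n = nvec 5 (core 5 p) in
               (2 * (1 + n 0 - n 1 - n 2 + n 3)) mod 5)"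

end

theory Submission
  imports Defs "HOL-Library.Infinite_Set" "HOL-Library.More_List"
begin

text \<open>
  A partition is encoded by its bead set \<open>{p_a - a - 1}\<close>. The \<open>i\<close>-th entry \<open>n_i\<close> of its \<open>n\<close>-vector modulo \<open>t\<close>
  is its charge on runner \<open>i\<close>, the number of beads congruent to \<open>i\<close> counted relative to the empty partition,
  and its size is the sum of its beads, counted in the same way. A skew shape is a rim hook of length \<open>t\<close> exactly
  when its contents run once through an interval of length \<open>t\<close>. In particular it meets each residue once, so a
  partition and its \<open>t\<close>-core have the same \<open>n\<close>-vector. Moving a bead down by \<open>t\<close> to a vacant position
  removes such a strip, so the beads of a core fill each runner up to its end, and the \<open>n\<close>-vector determines the
  core. Counting cells of the diagram by colour on a chessboard shows that \<open>srank\<close> modulo 4 is determined by the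
  size and by the charge of the even beads.

  For size \<open>4\<close> modulo \<open>5\<close>, Garvan, Kim and Stanton parametrise the \<open>n\<close>-vectors modulo 5 by integers
  \<open>a_0, ..., a_4\<close> with sum 1 such that rotating the \<open>a_i\<close> preserves the size of the 5-core and raises
  the 5-core crank by one. The rotation also preserves the number of odd entries among the runner ends
  \<open>5 n_i + i\<close>. Hence the runners of the abacus can be matched so that the rotated \<open>n\<close>-vector is reached by
  moving each runner rigidly by an even distance. This moves beads without changing their parity, so it
  preserves both the size and \<open>srank\<close> modulo 4. It is injective and advances the crank cyclically.
\<close>

subsection \<open>Relative sums over commensurable sets\<close>

definition commensurable :: "'a set \<Rightarrow> 'a set \<Rightarrow> bool" where
  "commensurable A B \<longleftrightarrow> finite (A - B) \<and> finite (B - A)"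

definition excess :: "('a \<Rightarrow> 'b::ab_group_add) \<Rightarrow> 'a set \<Rightarrow> 'a set \<Rightarrow> 'b" where
  "excess K A B = sum K (A - B) - sum K (B - A)"

lemma commensurable_sym: "commensurable A B \<Longrightarrow> commensurable B A"
  by (simp add: commensurable_def)

lemma commensurable_trans:
  assumes "commensurable A B" "commensurable B C"
  shows "commensurable A C"
proof -
  have "A - C \<subseteq> (A - B) \<union> (B - C)" "C - A \<subseteq> (C - B) \<union> (B - A)" by auto
  with assms show ?thesis
    unfolding commensurable_def by (meson finite_UnI finite_subset)
qed

lemma commensurable_image:
  assumes "inj f" "commensurable A B"
  shows "commensurable (f ` A) (f ` B)"
  using assms by (simp add: commensurable_def image_set_diff[symmetric])

lemma excess_eq_diff_sum_Int:
  assumes "finite U" "A - B \<subseteq> U" "B - A \<subseteq> U"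
  shows "excess K A B = sum K (U \<inter> A) - sum K (U \<inter> B)"
proof -
  have "sum K (U \<inter> A) = sum K (U \<inter> A \<inter> B) + sum K (A - B)"
    using assms sum.Int_Diff[of "U \<inter> A" K B] by (simp add: Int_Diff Int_absorb1)
  moreover have "U \<inter> B - A = B - A" using assms by auto
  hence "sum K (U \<inter> B) = sum K (U \<inter> A \<inter> B) + sum K (B - A)"
    using assms sum.Int_Diff[of "U \<inter> B" K A] by (simp add: Int_ac)
  ultimately show ?thesis by (simp add: excess_def)
qed

lemma excess_trans:
  assumes "commensurable A B" "commensurable B C"
  shows "excess K A B + excess K B C = excess K A C"
proof -
  define U where "U = (A - B) \<union> (B - A) \<union> (B - C) \<union> (C - B)"
  have "finite U" using assms by (simp add: U_def commensurable_def)
  hence "excess K A B = sum K (U \<inter> A) - sum K (U \<inter> B)"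
    "excess K B C = sum K (U \<inter> B) - sum K (U \<inter> C)"
    "excess K A C = sum K (U \<inter> A) - sum K (U \<inter> C)"
    by (rule excess_eq_diff_sum_Int; auto simp: U_def)+
  thus ?thesis by simp
qed

lemma excess_swap: "excess K A B = - excess K B A"
  by (simp add: excess_def)

lemma excess_image:
  assumes "inj f"
  shows "excess K (f ` A) (f ` B) = excess (K \<circ> f) A B"
  using assms
  by (simp add: excess_def image_set_diff[symmetric] sum.reindex inj_on_subset[OF assms])

lemma excess_add: "excess (\<lambda>x. K x + L x) A B = excess K A B + excess L A B"
  by (simp add: excess_def sum.distrib)

lemma excess_diff: "excess (\<lambda>x. K x - L x) A B = excess K A B - excess L A B"
  by (simp add: excess_def sum_subtractf)

lemma excess_mult:
  fixes c :: "'a::ring"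
  shows "excess (\<lambda>x. c * K x) A B = c * excess K A B"
  by (simp add: excess_def sum_distrib_left right_diff_distrib)

lemma excess_sum: "excess (\<lambda>x. \<Sum>i\<in>I. K i x) A B = (\<Sum>i\<in>I. excess (K i) A B)"
  by (simp add: excess_def sum_subtractf sum.swap[of _ I])

lemma commensurable_insert_remove: "commensurable (insert y (B - {x})) B"
  by (rule commensurable_def[THEN iffD2]) (auto intro: finite_subset[of _ "{x, y}"])

lemma excess_insert_remove:
  assumes "x \<in> B" "y \<notin> B"
  shows "excess K (insert y (B - {x})) B = K y - K x"
proof -
  have "insert y (B - {x}) - B = {y}" "B - insert y (B - {x}) = {x}" using assms by auto
  thus ?thesis by (simp add: excess_def)
qed

lemma finite_ge_if_commensurable:
  assumes "commensurable B {..<0::int}"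
  shows "finite {x \<in> B. k \<le> x}"
proof (rule finite_subset)
  show "{x \<in> B. k \<le> x} \<subseteq> (B - {..<0}) \<union> {k..<0}" by auto
  show "finite ((B - {..<0}) \<union> {k..<0})" using assms by (simp add: commensurable_def)
qed

lemma commensurable_lessThan: "commensurable {..<a::int} {..<b}"
proof -
  have "{..<a} - {..<b} = {b..<a}" "{..<b} - {..<a} = {a..<b}" by auto
  thus ?thesis by (simp add: commensurable_def)
qed

lemma excess_lessThan:
  assumes "a \<le> (b::int)"
  shows "excess K {..<b} {..<a} = sum K {a..<b}"
proof -
  have "{..<b} - {..<a} = {a..<b}" "{..<a} - {..<b} = {}" using assms by auto
  thus ?thesis by (simp add: excess_def)
qed

lemma image_add_lessThan: "(+) a ` {..<b} = {..<a + b :: 'a::linordered_ab_group_add}"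
proof
  show "{..<a + b} \<subseteq> (+) a ` {..<b}"
    by (auto simp: image_iff algebra_simps intro!: bexI[of _ "_ - a"])
qed auto

lemma excess_diff_translate:
  assumes B: "commensurable B {..<0::int}" and "t \<ge> 0"
  shows "excess (\<lambda>x. L (t + x) - L x) B {..<0} = excess L ((+) t ` B) B - sum L {0..<t}"
proof -
  have "commensurable ((+) t ` B) ((+) t ` {..<0})"
    by (rule commensurable_image[OF _ B]) simp
  hence tB: "commensurable ((+) t ` B) {..<t}" by (simp add: image_add_lessThan)
  have "excess (\<lambda>x. L (t + x)) B {..<0} = excess L ((+) t ` B) {..<t}"
    using excess_image[of "(+) t" L B "{..<0}"] by (simp add: o_def image_add_lessThan)
  moreover have "excess L ((+) t ` B) {..<t} + excess L {..<t} {..<0} = excess L ((+) t ` B) {..<0}"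
    using tB commensurable_lessThan by (rule excess_trans)
  moreover have "excess L ((+) t ` B) B + excess L B {..<0} = excess L ((+) t ` B) {..<0}"
    using commensurable_trans[OF tB commensurable_trans[OF commensurable_lessThan commensurable_sym[OF B]]] B
    by (rule excess_trans)
  ultimately show ?thesis
    using excess_lessThan[OF \<open>t \<ge> 0\<close>, of L] by (simp add: excess_diff algebra_simps)
qed

subsection \<open>Affine permutations\<close>

locale affine_permutation =
  fixes t :: int and \<phi> :: "int \<Rightarrow> int"
  assumes t_pos: "t > 0" and bij: "bij \<phi>" and translate: "\<phi> (t + x) = t + \<phi> x"
begin

lemma inj: "inj \<phi>"
  using bij by (rule bij_is_inj)

lemma translate_mult: "\<phi> (t * k + x) = t * k + \<phi> x"
proof (induction k rule: int_induct[where k = 0])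
  case (step1 k)
  thus ?case using translate[of "t * k + x"] by (simp add: algebra_simps)
next
  case (step2 k)
  thus ?case using translate[of "t * (k - 1) + x"] by (simp add: algebra_simps)
qed simp

lemma displacement_mod: "\<phi> (x mod t) - x mod t = \<phi> x - x"
  using translate_mult[of "x div t" "x mod t"] by (simp add: algebra_simps)

lemma displacement_bounded:
  obtains D where "\<And>x. \<bar>\<phi> x - x\<bar> \<le> D"
proof
  fix x
  have "x mod t \<in> {0..<t}" using t_pos by simp
  hence "\<bar>\<phi> (x mod t) - x mod t\<bar> \<le> (\<Sum>i\<in>{0..<t}. \<bar>\<phi> i - i\<bar>)"
    by (rule member_le_sum[of _ _ "\<lambda>i. \<bar>\<phi> i - i\<bar>"]) auto
  thus "\<bar>\<phi> x - x\<bar> \<le> (\<Sum>i\<in>{0..<t}. \<bar>\<phi> i - i\<bar>)" by (simp only: displacement_mod)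
qed

lemma commensurable_image_negative: "commensurable (\<phi> ` {..<0}) {..<0}"
proof -
  obtain D where D: "\<And>x. \<bar>\<phi> x - x\<bar> \<le> D" by (rule displacement_bounded) blast
  have "\<phi> ` {..<0} - {..<0} \<subseteq> {0..D}"
  proof
    fix y assume "y \<in> \<phi> ` {..<0} - {..<0}"
    then obtain x where "y = \<phi> x" "x < 0" "y \<ge> 0" by auto
    with D[of x] show "y \<in> {0..D}" by auto
  qed
  moreover have "{..<0} - \<phi> ` {..<0} \<subseteq> {- D..0}"
  proof
    fix y assume y: "y \<in> {..<0} - \<phi> ` {..<0}"
    obtain x where x: "y = \<phi> x" using bij by (metis bij_pointE)
    with y have "x \<ge> 0" by force
    with D[of x] x y show "y \<in> {- D..0}" by auto
  qed
  ultimately show ?thesis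
    unfolding commensurable_def by (meson finite_atLeastAtMost_int finite_subset)
qed

lemma commensurable_image_if_commensurable:
  assumes "commensurable B {..<0}"
  shows "commensurable (\<phi> ` B) {..<0}"
  using commensurable_image[OF inj assms] commensurable_image_negative by (rule commensurable_trans)

text \<open>The function \<open>L\<close> is a discrete antiderivative of \<open>c * K\<close> along the translation by \<open>t\<close>, so
  that the excess telescopes to one period.\<close>
lemma excess_image_negative:
  fixes c :: "'a::ring"
  assumes L: "\<And>x. L (t + x) - L x = c * K x"
  shows "c * excess K (\<phi> ` {..<0}) {..<0} = (\<Sum>i\<in>{0..<t}. L (\<phi> i) - L i)"
proof -
  have "(+) t ` \<phi> ` {..<0} = \<phi> ` (+) t ` {..<0}" by (simp only: image_image translate)
  also have "\<dots> = \<phi> ` {..<t}" by (simp add: image_add_lessThan)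
  finally have "excess L ((+) t ` \<phi> ` {..<0}) (\<phi> ` {..<0}) = (\<Sum>i\<in>{0..<t}. L (\<phi> i))"
    using t_pos by (simp add: excess_image[OF inj] excess_lessThan)
  thus ?thesis
    using excess_diff_translate[OF commensurable_image_negative, of t L] t_pos
    by (simp add: L excess_mult sum_subtractf)
qed

lemma excess_image_eq_excess_comp:
  assumes "commensurable B {..<0}"
  shows "excess K (\<phi> ` B) {..<0} = excess (K \<circ> \<phi>) B {..<0} + excess K (\<phi> ` {..<0}) {..<0}"
  using excess_trans[OF commensurable_image[OF inj assms] commensurable_image_negative, of K]
  by (simp add: excess_image[OF inj])

end

subsection \<open>Charges\<close>

definition charge :: "int \<Rightarrow> int set \<Rightarrow> int \<Rightarrow> int" where
  "charge t B i = excess (\<lambda>x. of_bool (x mod t = i mod t)) B {..<0}"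

definition balanced :: "int set \<Rightarrow> bool" where
  "balanced B \<longleftrightarrow> commensurable B {..<0} \<and> excess (\<lambda>_. 1 :: int) B {..<0} = 0"

definition energy :: "int set \<Rightarrow> int" where
  "energy B = excess (\<lambda>x. x) B {..<0}"

lemma charge_mod [simp]: "charge t B (i mod t) = charge t B i"
  by (simp add: charge_def)

lemma excess_periodic:
  assumes "t > 0"
  shows "excess (\<lambda>x. g (x mod t)) B {..<0} = (\<Sum>i\<in>{0..<t}. g i * charge t B i)"
proof -
  have "g (x mod t) = (\<Sum>i\<in>{0..<t}. g i * of_bool (x mod t = i mod t))" for x
  proof -
    have "(\<Sum>i\<in>{0..<t}. g i * of_bool (x mod t = i mod t)) = (\<Sum>i\<in>{0..<t}. if x mod t = i then g i else 0)"
      by (rule sum.cong) auto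
    thus ?thesis using assms by simp
  qed
  thus ?thesis by (simp only: excess_sum excess_mult charge_def)
qed

lemma excess_1_eq_sum_charge:
  "t > 0 \<Longrightarrow> excess (\<lambda>_. 1) B {..<0} = (\<Sum>i\<in>{0..<t}. charge t B i)"
  using excess_periodic[of t "\<lambda>_. 1" B] by simp

lemma energy_mod:
  assumes "t > 0"
  shows "energy B mod t = (\<Sum>i\<in>{0..<t}. i * charge t B i) mod t"
proof -
  have "energy B = excess (\<lambda>x. x mod t + t * (x div t)) B {..<0}" by (simp add: energy_def)
  also have "\<dots> = (\<Sum>i\<in>{0..<t}. i * charge t B i) + t * excess (\<lambda>x. x div t) B {..<0}"
    unfolding excess_add excess_mult excess_periodic[OF assms, of "\<lambda>i. i"] ..
  finally show ?thesis by simp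
qed

lemma (in affine_permutation) charge_2_image:
  assumes B: "commensurable B {..<0}" and t: "odd t"
    and even: "\<And>x. even (\<phi> x - x)" and sum: "(\<Sum>i\<in>{0..<t}. \<phi> i - i) = 0"
  shows "charge 2 (\<phi> ` B) 0 = charge 2 B 0"
proof -
  have \<phi>: "\<phi> x mod 2 = x mod 2" for x using even[of x] by (simp add: mod_eq_dvd_iff)
  have "2 * t * excess (\<lambda>x. of_bool (x mod 2 = 0 mod 2)) (\<phi> ` {..<0}) {..<0}
      = (\<Sum>i\<in>{0..<t}. (\<phi> i + t * of_bool (odd (\<phi> i))) - (i + t * of_bool (odd i)))"
    by (rule excess_image_negative) (use t in \<open>auto simp: even_iff_mod_2_eq_zero[symmetric]\<close>)
  also have "\<dots> = 0" using sum by (simp add: odd_iff_mod_2_eq_one \<phi>)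
  finally show ?thesis
    using t_pos by (simp add: charge_def excess_image_eq_excess_comp[OF B] o_def \<phi>)
qed

definition flush :: "int \<Rightarrow> int set \<Rightarrow> bool" where
  "flush t B \<longleftrightarrow> (\<forall>x\<in>B. x - t \<in> B)"

lemma flush_downward:
  assumes "flush t B" "t > 0" "x \<in> B" "y \<le> x" "y mod t = x mod t"
  shows "y \<in> B"
proof -
  have "x - t * int k \<in> B" for k
    by (induction k) (use assms(1,3) in \<open>auto simp: flush_def algebra_simps\<close>)
  moreover obtain k where "x - y = t * k" using assms(5) by (metis mod_eq_dvd_iff dvdE)
  moreover have "k \<ge> 0" using \<open>x - y = t * k\<close> assms(2,4) by (metis diff_ge_0_iff_ge zero_le_mult_iff not_less)
  ultimately show ?thesis by (metis add_diff_cancel_left' diff_add_cancel int_nat_eq)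
qed

lemma flush_subset_if_charge_le:
  assumes A: "flush t A" "commensurable A {..<0}" and B: "flush t B" "commensurable B {..<0}"
    and "t > 0" and charge_le: "\<And>i. charge t A i \<le> charge t B i"
  shows "A \<subseteq> B"
proof (rule ccontr)
  assume "\<not> A \<subseteq> B"
  then obtain x where x: "x \<in> A" "x \<notin> B" by blast
  define K :: "int \<Rightarrow> int" where "K = (\<lambda>y. of_bool (y mod t = x mod t))"
  have AB: "commensurable A B" using A(2) B(2) commensurable_sym commensurable_trans by blast
  hence "excess K A B + charge t B x = charge t A x"
    unfolding charge_def K_def using B(2) by (rule excess_trans)
  hence "excess K A B \<le> 0" using charge_le[of x] by simp
  moreover have "sum K (B - A) = 0"
  proof (rule sum.neutral, intro ballI)
    fix y assume "y \<in> B - A"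
    thus "K y = 0"
      using flush_downward[OF A(1) \<open>t > 0\<close> x(1), of y] flush_downward[OF B(1) \<open>t > 0\<close>, of y x] x
      by (cases "y \<le> x") (auto simp: K_def)
  qed
  moreover have "K x \<le> sum K (A - B)"
    using AB x by (intro member_le_sum) (auto simp: K_def commensurable_def)
  ultimately show False by (simp add: excess_def K_def)
qed

subsection \<open>Bead sets of partitions\<close>

abbreviation row :: "nat list \<Rightarrow> nat \<Rightarrow> nat" where
  "row p \<equiv> nth_default 0 p"

definition bead :: "nat list \<Rightarrow> nat \<Rightarrow> int" where
  "bead p a = int (row p a) - int a - 1"

definition beads :: "nat list \<Rightarrow> int set" where
  "beads p = range (bead p)"

lemma row_antimono:
  assumes "is_partition p" "a \<le> b"
  shows "row p b \<le> row p a"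
  using assms by (cases "a = b") (auto simp: nth_default_def is_partition_def sorted_wrt_iff_nth_less)

lemma row_inject:
  assumes "is_partition p" "is_partition q" "row p = row q"
  shows "p = q"
proof -
  have "strip_while (HOL.eq 0) r = r" if "is_partition r" for r
    using that by (intro strip_while_idem) (metis is_partition_def last_in_set no_trailing_unfold)
  thus ?thesis using assms by (metis nth_default_eq_iff)
qed

lemma ex_partition_rows:
  assumes f: "antimono f" and N: "f N = (0::nat)"
  obtains p where "is_partition p" "row p = f"
proof -
  define M where "M = (LEAST n. f n = 0)"
  have M: "f M = 0" unfolding M_def by (rule LeastI[of _ N]) (rule N)
  have positive: "f a > 0" if "a < M" for a
    using that not_less_Least unfolding M_def by blast
  have zero: "f a = 0" if "M \<le> a" for a
    using antimonoD[OF f that] M by simp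
  define p where "p = map f [0..<M]"
  have "is_partition p"
    using positive by (force simp: is_partition_def p_def sorted_wrt_iff_nth_less antimonoD[OF f])
  moreover have "row p = f"
    using zero by (auto simp: nth_default_def p_def)
  ultimately show ?thesis using that by blast
qed

lemma diagram_eq_Sigma: "diagram p = Sigma {..<length p} (\<lambda>a. {..<row p a})"
  by (auto simp: diagram_def nth_default_def)

lemma mem_diagram_iff: "(a, b) \<in> diagram p \<longleftrightarrow> b < row p a"
  by (auto simp: diagram_def nth_default_def)

lemma finite_diagram [simp]: "finite (diagram p)"
  by (simp add: diagram_eq_Sigma)

lemma diagram_downward:
  assumes "is_partition p" "(a, b) \<in> diagram p" "a' \<le> a" "b' \<le> b"
  shows "(a', b') \<in> diagram p"
  using row_antimono[OF assms(1,3)] assms(2,4) by (simp add: mem_diagram_iff)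

lemma sum_diagram: "(\<Sum>c\<in>diagram p. f c) = (\<Sum>a<length p. \<Sum>b<row p a. f (a, b))"
  by (simp add: diagram_eq_Sigma sum.Sigma)

lemma card_diagram: "card (diagram p) = sum_list p"
proof -
  have "card (diagram p) = (\<Sum>a<length p. row p a)" by (simp add: diagram_eq_Sigma)
  thus ?thesis by (simp add: nth_default_def sum_list_sum_nth atLeast0LessThan)
qed

lemma bead_less: "is_partition p \<Longrightarrow> a < b \<Longrightarrow> bead p b < bead p a"
  using row_antimono[of p a b] by (simp add: bead_def)

lemma inj_bead: "is_partition p \<Longrightarrow> inj (bead p)"
  using bead_less by (intro linorder_injI) (metis less_irrefl)

lemma bead_beyond: "length p \<le> a \<Longrightarrow> bead p a = - int a - 1"
  by (simp add: bead_def nth_default_beyond)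

lemma bead_ge: "bead p a \<ge> - int a - 1"
  by (simp add: bead_def)

lemma beads_eq_Un: "beads p = bead p ` {..<length p} \<union> {..<- int (length p)}"
proof -
  have "{..<- int (length p)} \<subseteq> bead p ` {length p..}"
  proof
    fix x assume "x \<in> {..<- int (length p)}"
    hence "x = bead p (nat (- x - 1))" "nat (- x - 1) \<in> {length p..}" by (auto simp: bead_beyond)
    thus "x \<in> bead p ` {length p..}" by blast
  qed
  hence "bead p ` {length p..} = {..<- int (length p)}" by (auto simp: bead_beyond)
  moreover have "UNIV = {..<length p} \<union> {length p..}" by auto
  ultimately show ?thesis unfolding beads_def by (metis image_Un)
qed

lemma beads_Diff_lessThan:
  "beads p - {..<- int (length p)} = bead p ` {..<length p}" "{..<- int (length p)} - beads p = {}"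
proof -
  have "- int (length p) \<le> bead p a" if "a < length p" for a
    using that bead_ge[of a p] by simp
  thus "beads p - {..<- int (length p)} = bead p ` {..<length p}" by (force simp: beads_eq_Un)
qed (auto simp: beads_eq_Un)

lemma commensurable_beads_lessThan: "commensurable (beads p) {..<- int (length p)}"
  unfolding commensurable_def beads_Diff_lessThan by simp

lemma commensurable_beads: "commensurable (beads p) {..<0}"
  using commensurable_beads_lessThan commensurable_lessThan by (rule commensurable_trans)

lemma excess_beads:
  assumes p: "is_partition p"
  shows "excess K (beads p) {..<0} = (\<Sum>a<length p. K (bead p a) - K (- int a - 1))"
proof -
  let ?l = "length p"
  have "excess K (beads p) {..<0} = excess K (beads p) {..<- int ?l} + excess K {..<- int ?l} {..<0}"
    using commensurable_beads_lessThan commensurable_lessThan by (rule excess_trans[symmetric])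
  also have "excess K (beads p) {..<- int ?l} = (\<Sum>a<?l. K (bead p a))"
    unfolding excess_def beads_Diff_lessThan
    by (simp add: sum.reindex inj_on_subset[OF inj_bead[OF p]])
  also have "excess K {..<- int ?l} {..<0} = - sum K {- int ?l..<0}"
    using excess_swap[of K "{..<- int ?l}"] by (simp add: excess_lessThan)
  also have "sum K {- int ?l..<0} = (\<Sum>a<?l. K (- int a - 1))"
    by (rule sum.reindex_bij_witness[where i = "\<lambda>a. - int a - 1" and j = "\<lambda>x. nat (- x - 1)"]) auto
  finally show ?thesis by (simp add: sum_subtractf)
qed

definition content :: "nat \<times> nat \<Rightarrow> int" where
  "content u = int (snd u) - int (fst u)"

lemma excess_beads_eq_sum_diagram:
  assumes p: "is_partition p"
  shows "excess K (beads p) {..<0} = (\<Sum>u\<in>diagram p. K (content u) - K (content u - 1))"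
proof -
  have "(\<Sum>b<m. K (int b - int a) - K (int b - int a - 1)) = K (int m - int a - 1) - K (- int a - 1)"
    for a m
    by (induction m) (auto simp: algebra_simps)
  thus ?thesis by (simp add: excess_beads[OF p] sum_diagram content_def bead_def)
qed

lemma balanced_beads: "is_partition p \<Longrightarrow> balanced (beads p)"
  by (simp add: balanced_def commensurable_beads excess_beads_eq_sum_diagram)

lemma energy_beads: "is_partition p \<Longrightarrow> energy (beads p) = int (sum_list p)"
  by (simp add: energy_def excess_beads_eq_sum_diagram card_diagram)

lemma card_greater_range_if_decreasing:
  fixes s :: "nat \<Rightarrow> 'a::linorder"
  assumes "\<And>a b. a < b \<Longrightarrow> s b < s a"
  shows "card {x \<in> range s. s a < x} = a"
proof -
  have "s a < s b \<longleftrightarrow> b < a" for b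
    using assms by (metis less_asym' linorder_neqE_nat order_less_irrefl)
  hence "{x \<in> range s. s a < x} = s ` {..<a}" by auto
  moreover have "inj s" using assms by (intro linorder_injI) (metis less_irrefl)
  ultimately show ?thesis by (simp add: card_image inj_on_subset)
qed

lemma card_beads_greater: "is_partition p \<Longrightarrow> card {x \<in> beads p. bead p a < x} = a"
  unfolding beads_def by (rule card_greater_range_if_decreasing) (rule bead_less)

lemma mem_diagram_iff_card_beads:
  assumes p: "is_partition p"
  shows "(a, b) \<in> diagram p \<longleftrightarrow> a < card {x \<in> beads p. content (a, b) \<le> x}"
proof -
  note fin = finite_ge_if_commensurable[OF commensurable_beads, of p]
  have mem: "(a, b) \<in> diagram p \<longleftrightarrow> content (a, b) \<le> bead p a"
    by (auto simp: mem_diagram_iff bead_def content_def)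
  show ?thesis
  proof (cases "(a, b) \<in> diagram p")
    case True
    hence "{x \<in> beads p. bead p a < x} \<subset> {x \<in> beads p. content (a, b) \<le> x}"
      by (auto simp: mem beads_def)
    from psubset_card_mono[OF fin this] True show ?thesis by (simp add: card_beads_greater[OF p])
  next
    case False
    hence "{x \<in> beads p. content (a, b) \<le> x} \<subseteq> {x \<in> beads p. bead p a < x}"
      by (auto simp: mem)
    moreover have "finite {x \<in> beads p. bead p a < x}"
      by (rule finite_subset[OF _ fin[of "bead p a"]]) auto
    ultimately have "card {x \<in> beads p. content (a, b) \<le> x} \<le> a"
      using card_mono card_beads_greater[OF p] by metis
    with False show ?thesis by simp
  qed
qed

lemma inj_on_beads: "inj_on beads {p. is_partition p}"
proof (rule inj_onI; clarify)
  fix p q assume p: "is_partition p" and q: "is_partition q" and eq: "beads p = beads q"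
  have "(a, b) \<in> diagram p \<longleftrightarrow> (a, b) \<in> diagram q" for a b
    by (simp only: mem_diagram_iff_card_beads p q eq)
  hence "b < row p a \<longleftrightarrow> b < row q a" for a b by (simp only: mem_diagram_iff)
  hence "row p a = row q a" for a by (metis linorder_neqE_nat less_irrefl)
  thus "p = q" using p q by (intro row_inject) auto
qed

lemma ex_decreasing_enumeration:
  fixes S :: "int set"
  assumes "infinite S" "bdd_above S"
  obtains s :: "nat \<Rightarrow> int" where "\<And>a b. a < b \<Longrightarrow> s b < s a" "range s = S"
proof -
  obtain M where M: "\<And>x. x \<in> S \<Longrightarrow> x \<le> M" using assms(2) by (auto simp: bdd_above_def)
  define T where "T = {k. M - int k \<in> S}"
  have S: "(\<lambda>k. M - int k) ` T = S"
  proof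
    show "S \<subseteq> (\<lambda>k. M - int k) ` T"
    proof
      fix x assume "x \<in> S"
      with M[of x] have "x = M - int (nat (M - x))" "nat (M - x) \<in> T" by (simp_all add: T_def)
      thus "x \<in> (\<lambda>k. M - int k) ` T" by (rule image_eqI)
    qed
  qed (auto simp: T_def)
  hence T: "infinite T" using assms(1) by (metis finite_imageI)
  define s where "s = (\<lambda>k. M - int k) \<circ> enumerate T"
  have "range s = S" unfolding s_def image_comp[symmetric] range_enumerate[OF T] by (rule S)
  moreover have "s b < s a" if "a < b" for a b
    using enumerate_mono[OF that T] by (simp add: s_def)
  ultimately show ?thesis using that by blast
qed

lemma decreasing_enumeration_eventually_eq:
  assumes S: "balanced S" and decreasing: "\<And>a b. a < b \<Longrightarrow> s b < s a" and range: "range s = S"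
  obtains N where "\<And>a. N \<le> a \<Longrightarrow> s a = - int a - 1"
proof -
  have commensurable: "commensurable S {..<0}" using S by (simp add: balanced_def)
  hence "bdd_below ({..<0} - S)" by (simp add: commensurable_def bdd_below_finite)
  then obtain l where l: "\<And>x. x \<in> {..<0} - S \<Longrightarrow> l \<le> x" by (auto simp: bdd_below_def)
  define N where "N = nat (s 0 - min l 0)"
  have linear_bound: "s a \<le> s 0 - int a" for a
  proof (induction a)
    case (Suc a)
    thus ?case using decreasing[of a "Suc a"] by simp
  qed simp
  have small: "s a < min l 0" if "N < a" for a
    using linear_bound[of a] that unfolding N_def by linarith
  have "s a = - int a - 1" if "N < a" for a
  proof -
    have "x \<in> S" if "x < s a + 1" for x
      using l[of x] small[OF \<open>_ < a\<close>] that by (cases "x \<in> S") auto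
    hence diff: "S - {..<s a + 1} = {x \<in> S. s a < x}" "{..<s a + 1} - S = {}" by auto
    have "card {x \<in> S. s a < x} = a"
      using card_greater_range_if_decreasing[of s, OF decreasing] range by simp
    moreover have "finite {x \<in> S. s a < x}"
      by (rule finite_subset[OF _ finite_ge_if_commensurable[OF commensurable, of "s a"]]) auto
    ultimately have "commensurable S {..<s a + 1}" "excess (\<lambda>_. 1) S {..<s a + 1} = int a"
      unfolding commensurable_def excess_def diff by simp_all
    moreover have "excess (\<lambda>_. 1) {..<s a + 1} {..<0} = s a + 1"
      using small[OF that] excess_swap[of "\<lambda>_. 1::int" "{..<s a + 1}"] by (simp add: excess_lessThan)
    ultimately show ?thesis
      using S excess_trans[OF _ commensurable_lessThan, of S "s a + 1" "\<lambda>_. 1::int" 0]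
      by (simp add: balanced_def)
  qed
  thus ?thesis by (intro that[of "Suc N"]) (simp add: Suc_le_eq)
qed

lemma ex_partition_beads:
  assumes S: "balanced S"
  obtains p where "is_partition p" "beads p = S"
proof -
  have finite_diff: "finite (S - {..<0})" "finite ({..<0} - S)"
    using S by (simp_all add: balanced_def commensurable_def)
  have "infinite S" using finite_diff(2) infinite_Iio[of "0::int"] by (metis finite_Diff2)
  moreover have "bdd_above ((S - {..<0}) \<union> {..<0})"
    using finite_diff(1) by (intro bdd_above_Un[THEN iffD2]) (simp add: bdd_above_finite)
  hence "bdd_above S" by (rule bdd_above_mono) auto
  ultimately obtain s :: "nat \<Rightarrow> int" where decreasing: "\<And>a b. a < b \<Longrightarrow> s b < s a" and range: "range s = S"
    by (rule ex_decreasing_enumeration) blast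
  obtain N where N: "\<And>a. N \<le> a \<Longrightarrow> s a = - int a - 1"
    using decreasing_enumeration_eventually_eq[OF S decreasing range] by blast
  define r where "r = (\<lambda>a. s a + int a + 1)"
  have "r (Suc a) \<le> r a" for a
    using decreasing[of a "Suc a"] by (simp add: r_def)
  hence anti: "r b \<le> r a" if "a \<le> b" for a b
    using that by (rule lift_Suc_antimono_le)
  have nonneg: "0 \<le> r a" for a
    using anti[of a "max a N"] N[of "max a N"] by (simp add: r_def)
  have "antimono (nat \<circ> r)" by (intro antimonoI) (simp add: anti nat_mono)
  moreover have "(nat \<circ> r) N = 0" using N by (simp add: r_def)
  ultimately obtain p where p: "is_partition p" "row p = nat \<circ> r" by (rule ex_partition_rows)
  have "bead p = s" using nonneg by (simp add: fun_eq_iff bead_def p) (simp add: r_def)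
  with p range that show ?thesis by (simp add: beads_def)
qed

lemma bij_betw_beads: "bij_betw beads {p. is_partition p} {S. balanced S}"
proof (rule bij_betw_imageI[OF inj_on_beads])
  show "beads ` {p. is_partition p} = {S. balanced S}"
    using balanced_beads by (auto elim!: ex_partition_beads)
qed

subsection \<open>Rim hooks and cores\<close>

definition convex_cells :: "(nat \<times> nat) set \<Rightarrow> bool" where
  "convex_cells S \<longleftrightarrow> (\<forall>a b a' b' a'' b''. (a, b) \<in> S \<longrightarrow> (a'', b'') \<in> S \<longrightarrow>
     a \<le> a' \<longrightarrow> a' \<le> a'' \<longrightarrow> b \<le> b' \<longrightarrow> b' \<le> b'' \<longrightarrow> (a', b') \<in> S)"

lemma convex_cellsD:
  assumes "convex_cells S" "(a, b) \<in> S" "(a'', b'') \<in> S" "a \<le> a'" "a' \<le> a''" "b \<le> b'" "b' \<le> b''"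
  shows "(a', b') \<in> S"
  using assms unfolding convex_cells_def by blast

lemma convex_cells_skew:
  assumes "is_partition p" "is_partition q"
  shows "convex_cells (diagram p - diagram q)"
  unfolding convex_cells_def using assms by (meson DiffD1 DiffD2 DiffI diagram_downward)

lemma diagonal_notin_if_inj_on_content:
  assumes "inj_on content S" "(a, b) \<in> S"
  shows "(a + 1, b + 1) \<notin> S"
proof
  assume "(a + 1, b + 1) \<in> S"
  moreover have "content (a + 1, b + 1) = content (a, b)" by (simp add: content_def)
  ultimately have "(a + 1, b + 1) = (a, b)" using assms inj_onD by metis
  thus False by simp
qed

lemma inj_on_content_iff_no_2x2:
  assumes S: "convex_cells S"
  shows "inj_on content S \<longleftrightarrow> no_2x2 S"
proof
  assume "inj_on content S"
  thus "no_2x2 S" unfolding no_2x2_def using diagonal_notin_if_inj_on_content by blast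
next
  assume "no_2x2 S"
  hence not_northwest: "\<not> (a < c \<and> b < d)" if "(a, b) \<in> S" "(c, d) \<in> S" for a b c d
    using convex_cellsD[OF S that] that unfolding no_2x2_def by fastforce
  show "inj_on content S"
  proof (rule inj_onI)
    fix u v assume uv: "u \<in> S" "v \<in> S" "content u = content v"
    obtain a b c d where [simp]: "u = (a, b)" "v = (c, d)" by fastforce
    have "\<not> (a < c \<and> b < d)" "\<not> (c < a \<and> d < b)" using not_northwest uv by auto
    thus "u = v" using uv(3) by (auto simp: content_def)
  qed
qed

lemma contents_connected:
  assumes S: "cells_connected S" and u: "u \<in> S" and v: "v \<in> S"
  shows "{content u..content v} \<subseteq> content ` S"
proof -
  have "(u, v) \<in> {(u, v). u \<in> S \<and> v \<in> S \<and> cell_adj u v}\<^sup>*"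
    using assms by (simp add: cells_connected_def)
  thus ?thesis
  proof (induction rule: rtrancl_induct)
    case base
    thus ?case using u by auto
  next
    case (step y z)
    hence "content z \<le> content y + 1" "z \<in> S" by (auto simp: cell_adj_def content_def)
    hence "{content u..content z} \<subseteq> insert (content z) {content u..content y}" by auto
    thus ?case using step.IH \<open>z \<in> S\<close> by auto
  qed
qed

lemma cell_adj_if_content_succ:
  assumes S: "convex_cells S" and inj: "inj_on content S" and u: "u \<in> S" and v: "v \<in> S"
    and succ: "content v = content u + 1"
  shows "cell_adj u v"
proof -
  obtain a b c d where [simp]: "u = (a, b)" "v = (c, d)" by fastforce
  have no_diagonal: "(a + 1, b + 1) \<notin> S" "(c + 1, d + 1) \<notin> S"
    using diagonal_notin_if_inj_on_content[OF inj] u v by auto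
  have "\<not> a < c"
    using no_diagonal(1) convex_cellsD[OF S u[simplified] v[simplified], of "a + 1" "b + 1"] succ
    by (auto simp: content_def)
  moreover have "\<not> c + 1 < a"
    using no_diagonal(2) convex_cellsD[OF S v[simplified] u[simplified], of "c + 1" "d + 1"] succ
    by (auto simp: content_def)
  ultimately have "c = a \<or> a = c + 1" by linarith
  thus ?thesis using succ by (auto simp: cell_adj_def content_def)
qed

lemma cells_connected_if_contents_interval:
  assumes S: "convex_cells S" and bij: "bij_betw content S {l..<h}"
  shows "cells_connected S"
proof -
  define R where "R = {(u, v). u \<in> S \<and> v \<in> S \<and> cell_adj u v}"
  have "sym R" by (auto simp: sym_def R_def cell_adj_def)
  have inj: "inj_on content S" and range: "content ` S = {l..<h}"
    using bij by (simp_all add: bij_betw_def)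
  have ascending: "(u, v) \<in> R\<^sup>*" if "u \<in> S" "v \<in> S" "content v = content u + int k" for u v k
    using that
  proof (induction k arbitrary: v)
    case 0
    hence "u = v" using inj by (auto dest: inj_onD)
    thus ?case by simp
  next
    case (Suc k)
    have "content u \<in> {l..<h}" "content v \<in> {l..<h}" using bij_betw_apply[OF bij] Suc.prems(1,2) by blast+
    hence "content u + int k \<in> content ` S" using Suc.prems(3) by (simp add: range)
    then obtain w where w: "w \<in> S" "content w = content u + int k" by (metis imageE)
    hence "cell_adj w v" using Suc.prems by (intro cell_adj_if_content_succ[OF S inj]) auto
    hence "(w, v) \<in> R" using w Suc.prems by (simp add: R_def)
    with Suc.IH[OF Suc.prems(1) w] show ?case by (rule rtrancl_into_rtrancl)
  qed
  show ?thesis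
    unfolding cells_connected_def R_def[symmetric]
  proof (intro ballI)
    fix u v assume uv: "u \<in> S" "v \<in> S"
    show "(u, v) \<in> R\<^sup>*"
    proof (cases "content u \<le> content v")
      case True
      thus ?thesis using ascending[OF uv, of "nat (content v - content u)"] by simp
    next
      case False
      hence "(v, u) \<in> R\<^sup>*" using ascending[OF uv(2,1), of "nat (content u - content v)"] by simp
      thus ?thesis using sym_rtrancl[OF \<open>sym R\<close>] by (auto dest: symD)
    qed
  qed
qed

lemma eq_atLeastLessThan_if_interval_closed:
  fixes C :: "int set"
  assumes "finite C" and closed: "\<And>x y. x \<in> C \<Longrightarrow> y \<in> C \<Longrightarrow> {x..y} \<subseteq> C"
  shows "\<exists>l. C = {l..<l + int (card C)}"
proof (cases "C = {}")
  case False
  have "C = {Min C..Max C}"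
    using closed[OF Min_in Max_in] assms(1) False by (auto intro!: Min_le Max_ge)
  then obtain l h where C: "C = {l..h}" ..
  with False have "C = {l..<l + int (card C)}" by auto
  thus ?thesis ..
qed simp

lemma remove_hook_iff_contents_interval:
  assumes p: "is_partition p" and q: "is_partition q"
  shows "remove_hook t p q \<longleftrightarrow> diagram q \<subseteq> diagram p \<and>
    (\<exists>l. bij_betw content (diagram p - diagram q) {l..<l + int t})"
proof -
  define S where "S = diagram p - diagram q"
  have S: "convex_cells S" using convex_cells_skew[OF p q] by (simp add: S_def)
  have "card S = t \<and> cells_connected S \<and> no_2x2 S \<longleftrightarrow> (\<exists>l. bij_betw content S {l..<l + int t})"
  proof
    assume hook: "card S = t \<and> cells_connected S \<and> no_2x2 S"
    hence inj: "inj_on content S" using inj_on_content_iff_no_2x2[OF S] by simp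
    have "{x..y} \<subseteq> content ` S" if "x \<in> content ` S" "y \<in> content ` S" for x y
      using that hook contents_connected by blast
    hence "\<exists>l. content ` S = {l..<l + int (card (content ` S))}"
      by (intro eq_atLeastLessThan_if_interval_closed) (simp add: S_def)
    thus "\<exists>l. bij_betw content S {l..<l + int t}"
      using inj hook by (simp add: bij_betw_def card_image)
  next
    assume "\<exists>l. bij_betw content S {l..<l + int t}"
    then obtain l where l: "bij_betw content S {l..<l + int t}" ..
    have "card S = t" using bij_betw_same_card[OF l] by simp
    thus "card S = t \<and> cells_connected S \<and> no_2x2 S"
      using l cells_connected_if_contents_interval[OF S l] inj_on_content_iff_no_2x2[OF S]
      by (simp add: bij_betw_def)
  qed
  thus ?thesis using p q by (auto simp: remove_hook_def S_def)
qed

lemma card_content_eq_excess: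
  assumes p: "is_partition p"
  shows "int (card {u \<in> diagram p. content u = k}) = excess (\<lambda>x. of_bool (k \<le> x)) (beads p) {..<0}"
proof -
  have "excess (\<lambda>x. of_bool (k \<le> x)) (beads p) {..<0} = (\<Sum>u\<in>diagram p. of_bool (content u = k) :: int)"
    unfolding excess_beads_eq_sum_diagram[OF p] by (rule sum.cong) auto
  thus ?thesis by (simp add: of_bool_def sum.If_cases Int_def)
qed

lemma bij_betw_if_card_fibres:
  assumes "finite A" and card: "\<And>y. card {x \<in> A. f x = y} = of_bool (y \<in> B)"
  shows "bij_betw f A B"
proof -
  have fibre: "f x \<in> B \<and> {x' \<in> A. f x' = f x} = {x}" if "x \<in> A" for x
  proof -
    have "{x' \<in> A. f x' = f x} \<noteq> {}" using that by auto
    hence fx: "f x \<in> B" using assms(1) card[of "f x"] by (cases "f x \<in> B") auto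
    hence "card {x' \<in> A. f x' = f x} = 1" using card[of "f x"] by simp
    then obtain z where "{x' \<in> A. f x' = f x} = {z}" by (rule card_1_singletonE)
    moreover have "x \<in> {x' \<in> A. f x' = f x}" using that by simp
    ultimately show ?thesis using fx by simp
  qed
  have "inj_on f A"
  proof (rule inj_onI)
    fix x y assume "x \<in> A" "y \<in> A" "f x = f y"
    hence "y \<in> {x' \<in> A. f x' = f x}" by simp
    thus "x = y" unfolding conjunct2[OF fibre[OF \<open>x \<in> A\<close>]] by simp
  qed
  moreover have "y \<in> f ` A" if "y \<in> B" for y
  proof -
    have "{x \<in> A. f x = y} \<noteq> {}" using card[of y] that by force
    thus ?thesis by blast
  qed
  ultimately show ?thesis unfolding bij_betw_def using fibre by blast
qed

lemma diagram_subset_if_bead_moved_down: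
  assumes p: "is_partition p" and q: "is_partition q" and "y < x"
    and x: "x \<in> beads p" and beads: "beads q = insert y (beads p - {x})"
  shows "diagram q \<subseteq> diagram p"
proof -
  have card_le: "card {z \<in> beads q. k \<le> z} \<le> card {z \<in> beads p. k \<le> z}" for k
  proof -
    note fin = finite_ge_if_commensurable[OF commensurable_beads, of p k]
    show ?thesis
    proof (cases "k \<le> y")
      case True
      hence "{z \<in> beads q. k \<le> z} = insert y ({z \<in> beads p. k \<le> z} - {x})" by (auto simp: beads)
      also have "card \<dots> \<le> Suc (card ({z \<in> beads p. k \<le> z} - {x}))" by (rule card_insert_le_m1) auto
      also have "\<dots> = card {z \<in> beads p. k \<le> z}"
        using x True \<open>y < x\<close> by (intro card_Suc_Diff1[OF fin]) auto
      finally show ?thesis .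
    next
      case False
      thus ?thesis by (intro card_mono[OF fin]) (auto simp: beads)
    qed
  qed
  show ?thesis
    using less_le_trans[OF _ card_le] by (intro subrelI) (simp only: mem_diagram_iff_card_beads p q)
qed

lemma remove_hook_if_bead_moved_down:
  assumes p: "is_partition p" and q: "is_partition q" and t: "t > 0"
    and x: "x \<in> beads p" and y: "x - int t \<notin> beads p"
    and beads: "beads q = insert (x - int t) (beads p - {x})"
  shows "remove_hook t p q"
proof -
  let ?I = "{x - int t + 1..<x - int t + 1 + int t}"
  have subset: "diagram q \<subseteq> diagram p"
    using t by (intro diagram_subset_if_bead_moved_down[OF p q _ x beads]) simp
  have "card {u \<in> diagram p - diagram q. content u = k} = of_bool (k \<in> ?I)" for k
  proof -
    let ?K = "\<lambda>x. of_bool (k \<le> x) :: int"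
    have "excess ?K (beads q) (beads p) + excess ?K (beads p) {..<0} = excess ?K (beads q) {..<0}"
      using commensurable_insert_remove commensurable_beads unfolding beads by (rule excess_trans)
    hence "excess ?K (beads p) {..<0} = excess ?K (beads q) {..<0} + of_bool (k \<in> ?I)"
      using excess_insert_remove[OF x y, of ?K] by (auto simp: beads)
    hence "card {u \<in> diagram p. content u = k} = card {u \<in> diagram q. content u = k} + of_bool (k \<in> ?I)"
      unfolding card_content_eq_excess[OF p, symmetric] card_content_eq_excess[OF q, symmetric]
      by (simp only: of_nat_of_bool[where ?'a = int, symmetric] of_nat_add[symmetric] of_nat_eq_iff)
    moreover have "{u \<in> diagram p - diagram q. content u = k} =
        {u \<in> diagram p. content u = k} - {u \<in> diagram q. content u = k}" by auto
    moreover have "{u \<in> diagram q. content u = k} \<subseteq> {u \<in> diagram p. content u = k}" using subset by auto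
    ultimately show ?thesis by (simp add: card_Diff_subset)
  qed
  hence "bij_betw content (diagram p - diagram q) ?I"
    by (intro bij_betw_if_card_fibres) auto
  with subset show ?thesis using remove_hook_iff_contents_interval[OF p q] by blast
qed

lemma flush_core:
  assumes core: "is_core t k" and t: "t > 0"
  shows "flush (int t) (beads k)"
  unfolding flush_def
proof (intro ballI, rule ccontr)
  fix x assume x: "x \<in> beads k" and y: "x - int t \<notin> beads k"
  have k: "is_partition k" using core by (simp add: is_core_def)
  let ?B = "insert (x - int t) (beads k - {x})"
  have "excess (\<lambda>_. 1::int) ?B (beads k) + excess (\<lambda>_. 1) (beads k) {..<0} = excess (\<lambda>_. 1) ?B {..<0}"
    using commensurable_insert_remove commensurable_beads by (rule excess_trans)
  moreover have "commensurable ?B {..<0}"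
    using commensurable_insert_remove commensurable_beads by (rule commensurable_trans)
  ultimately have "balanced ?B"
    using balanced_beads[OF k] excess_insert_remove[OF x y, of "\<lambda>_. 1::int"] by (simp add: balanced_def)
  then obtain q where "is_partition q" "beads q = ?B" by (rule ex_partition_beads)
  hence "remove_hook t k q" by (intro remove_hook_if_bead_moved_down[OF k _ t x y])
  with core show False by (auto simp: is_core_def)
qed

lemma card_residue_atLeastLessThan:
  fixes t :: int
  assumes "t > 0"
  shows "card {x \<in> {l..<l + t}. x mod t = i mod t} = 1"
proof -
  define y where "y = l + (i - l) mod t"
  have y: "y \<in> {l..<l + t}" using assms by (simp add: y_def)
  have y_mod: "y mod t = i mod t" by (simp add: y_def mod_add_right_eq)
  have "x = y" if x: "x \<in> {l..<l + t}" "x mod t = i mod t" for x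
  proof -
    have "t dvd x - y" using x y_mod by (metis mod_eq_dvd_iff)
    moreover have "\<bar>x - y\<bar> < t" using x y by auto
    ultimately show "x = y" using dvd_imp_le_int[of "x - y" t] by (cases "x = y") auto
  qed
  hence "{x \<in> {l..<l + t}. x mod t = i mod t} = {y}" using y y_mod by blast
  thus ?thesis by simp
qed

lemma res_count_eq_card_content:
  "res_count t p i = int (card {u \<in> diagram p. content u mod int t = int i})"
  unfolding res_count_def content_def by (rule arg_cong[where f = "\<lambda>X. int (card X)"]) auto

lemma res_count_remove_hook:
  assumes hook: "remove_hook t p q" and i: "i < t"
  shows "res_count t p i = res_count t q i + 1"
proof -
  define P where "P = (\<lambda>u. content u mod int t = int i)"
  have subset: "diagram q \<subseteq> diagram p" using hook by (simp add: remove_hook_def)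
  obtain l where l: "bij_betw content (diagram p - diagram q) {l..<l + int t}"
    using hook remove_hook_iff_contents_interval[of p q t] by (auto simp: remove_hook_def)
  have "bij_betw content {u \<in> diagram p - diagram q. P u} {x \<in> {l..<l + int t}. x mod int t = int i mod int t}"
    using l i by (auto simp: P_def bij_betw_def inj_on_def)
  hence "card {u \<in> diagram p - diagram q. P u} = 1"
    using bij_betw_same_card card_residue_atLeastLessThan[of "int t" l "int i"] i by fastforce
  moreover have "{u \<in> diagram p - diagram q. P u} = {u \<in> diagram p. P u} - {u \<in> diagram q. P u}" by auto
  moreover have subset_P: "{u \<in> diagram q. P u} \<subseteq> {u \<in> diagram p. P u}" using subset by auto
  moreover have "card {u \<in> diagram q. P u} \<le> card {u \<in> diagram p. P u}" by (rule card_mono[OF _ subset_P]) simp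
  moreover have "res_count t r i = int (card {u \<in> diagram r. P u})" for r
    unfolding P_def by (rule res_count_eq_card_content)
  ultimately show ?thesis by (simp add: card_Diff_subset)
qed

lemma nvec_remove_hooks:
  assumes "(remove_hook t)\<^sup>*\<^sup>* p q" and "i < t"
  shows "nvec t p i = nvec t q i"
  using assms by (induction rule: rtranclp_induct) (auto simp: nvec_def res_count_remove_hook)

lemma nvec_eq_charge:
  assumes p: "is_partition p" and i: "i < t"
  shows "nvec t p i = charge (int t) (beads p) (int i)"
proof -
  have pred: "(x - 1) mod int t = int i \<longleftrightarrow> x mod int t = int ((i + 1) mod t)" for x
  proof -
    have "(x - 1) mod int t = int i \<longleftrightarrow> (x - 1) mod int t = int i mod int t" using i by simp
    also have "\<dots> \<longleftrightarrow> x mod int t = (int i + 1) mod int t"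
      by (metis diff_add_cancel mod_add_left_eq mod_diff_left_eq add_diff_cancel)
    finally show ?thesis by (simp add: zmod_int add.commute)
  qed
  have "res_count t p j = (\<Sum>u\<in>diagram p. of_bool (content u mod int t = int j))" for j
    by (simp add: res_count_eq_card_content of_bool_def sum.If_cases Int_def)
  thus ?thesis
    using i by (simp add: nvec_def charge_def excess_beads_eq_sum_diagram[OF p] pred sum_subtractf)
qed

lemma ex_core:
  assumes "is_partition p" "t > 0"
  shows "\<exists>k. is_core t k \<and> (remove_hook t)\<^sup>*\<^sup>* p k"
  using assms(1)
proof (induction "card (diagram p)" arbitrary: p rule: less_induct)
  case less
  show ?case
  proof (cases "is_core t p")
    case False
    then obtain q where q: "remove_hook t p q" using less.prems by (auto simp: is_core_def)
    hence "diagram p - diagram q \<noteq> {}" "diagram q \<subseteq> diagram p" "is_partition q"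
      using \<open>t > 0\<close> by (auto simp: remove_hook_def)
    hence "card (diagram q) < card (diagram p)"
      by (intro psubset_card_mono) auto
    then obtain k where "is_core t k" "(remove_hook t)\<^sup>*\<^sup>* q k"
      using less.hyps \<open>is_partition q\<close> by blast
    thus ?thesis using q by (meson converse_rtranclp_into_rtranclp)
  qed blast
qed

lemma core_eqI:
  assumes k: "is_core t k" and l: "is_core t l" and t: "t > 0"
    and nvec: "\<And>i. i < t \<Longrightarrow> nvec t k i = nvec t l i"
  shows "k = l"
proof -
  have p: "is_partition k" "is_partition l" using k l by (simp_all add: is_core_def)
  have "charge (int t) (beads k) i = charge (int t) (beads l) i" for i
  proof -
    have "nat (i mod int t) < t" using t by (simp add: nat_less_iff)
    with nvec[OF this] show ?thesis using t by (simp add: nvec_eq_charge p)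
  qed
  hence "beads k = beads l"
    using t by (intro equalityI flush_subset_if_charge_le[of "int t"] flush_core k l commensurable_beads) auto
  thus ?thesis using inj_on_beads p by (auto dest: inj_onD)
qed

lemma nvec_core:
  assumes p: "is_partition p" and i: "i < t"
  shows "nvec t (core t p) i = nvec t p i"
proof -
  have "\<exists>!k. is_core t k \<and> (remove_hook t)\<^sup>*\<^sup>* p k"
  proof (rule ex_ex1I)
    show "\<exists>k. is_core t k \<and> (remove_hook t)\<^sup>*\<^sup>* p k" using ex_core p i by auto
    show "k = l" if "is_core t k \<and> (remove_hook t)\<^sup>*\<^sup>* p k" "is_core t l \<and> (remove_hook t)\<^sup>*\<^sup>* p l" for k l
      using that i by (intro core_eqI[of t]) (auto simp flip: nvec_remove_hooks)
  qed
  from theI'[OF this] have "(remove_hook t)\<^sup>*\<^sup>* p (core t p)" by (simp add: core_def)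
  thus ?thesis using nvec_remove_hooks i by metis
qed

subsection \<open>The Stanley rank modulo 4\<close>

lemma less_length_filter_iff:
  assumes "sorted_wrt (\<ge>) p"
  shows "a < length (filter (\<lambda>x. b < x) p) \<longleftrightarrow> b < row p a"
  using assms
proof (induction p arbitrary: a)
  case (Cons x p)
  show ?case
  proof (cases "b < x")
    case True
    thus ?thesis using Cons by (cases a) auto
  next
    case False
    hence "filter (\<lambda>x. b < x) (x # p) = []" using Cons.prems by (auto simp: filter_empty_conv)
    moreover have "row (x # p) a \<le> x"
      using Cons.prems nth_mem[of "a - 1" p] by (cases a) (auto simp: nth_default_def)
    ultimately show ?thesis using False by simp
  qed
qed simp

lemma less_row_conj_part_iff:
  assumes "is_partition p"
  shows "a < row (conj_part p) b \<longleftrightarrow> b < row p a"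
proof -
  have "b < row p a \<Longrightarrow> b < row p 0" using row_antimono[OF assms, of 0 a] by simp
  moreover have "row p 0 = (if p = [] then 0 else hd p)" by (cases p) auto
  ultimately show ?thesis
    using less_length_filter_iff[of p a b] assms
    by (auto simp: conj_part_def nth_default_def nth_default_eq_dflt_iff is_partition_def)
qed

lemma diagram_conj_part: "is_partition p \<Longrightarrow> diagram (conj_part p) = prod.swap ` diagram p"
  by (rule set_eqI) (simp add: split_paired_all mem_diagram_iff less_row_conj_part_iff)

lemma num_odd_eq_sum: "int (num_odd p) = (\<Sum>u\<in>diagram p. (- 1) ^ snd u)"
proof -
  have "(\<Sum>b<m. (- 1) ^ b) = (of_bool (odd m) :: int)" for m
    by (induction m) auto
  moreover have "{a. a < length p \<and> odd (p ! a)} = {a \<in> {..<length p}. odd (row p a)}"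
    by (auto simp: nth_default_def)
  hence "int (num_odd p) = (\<Sum>a<length p. of_bool (odd (row p a)))"
    by (simp add: num_odd_def length_filter_conv_card of_bool_def sum.If_cases Int_def)
  ultimately show ?thesis by (simp add: sum_diagram)
qed

lemma num_odd_conj_part_eq_sum:
  assumes "is_partition p"
  shows "int (num_odd (conj_part p)) = (\<Sum>u\<in>diagram p. (- 1) ^ fst u)"
  unfolding num_odd_eq_sum diagram_conj_part[OF assms] by (simp add: sum.reindex)

lemma srank_mod_4:
  assumes p: "is_partition p"
  shows "srank p mod 4 = (int (sum_list p) - nvec 2 p 0) mod 4"
proof -
  define white black :: "nat \<times> nat \<Rightarrow> int" where
    "white = (\<lambda>u. of_bool (content u mod 2 = 0))" and "black = (\<lambda>u. of_bool (content u mod 2 = 1))"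
  have "nvec 2 p 0 = sum white (diagram p) - sum black (diagram p)"
    by (simp add: nvec_def res_count_eq_card_content white_def black_def of_bool_def sum.If_cases Int_def)
  hence "srank p - (int (sum_list p) - nvec 2 p 0) =
    (\<Sum>u\<in>diagram p. (- 1) ^ snd u - (- 1) ^ fst u - 1 + (white u - black u))"
    unfolding srank_def num_odd_conj_part_eq_sum[OF p] num_odd_eq_sum[of p]
    by (simp add: card_diagram[symmetric] sum_subtractf sum.distrib)
  also have "4 dvd \<dots>"
  proof (rule dvd_sum)
    fix u :: "nat \<times> nat"
    show "4 dvd (- 1) ^ snd u - (- 1) ^ fst u - 1 + (white u - black u)"
      by (cases "even (fst u)"; cases "even (snd u)")
        (auto simp: white_def black_def content_def even_iff_mod_2_eq_zero[symmetric]
          odd_iff_mod_2_eq_one[symmetric])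
  qed
  finally show ?thesis by (simp add: mod_eq_dvd_iff)
qed

subsection \<open>Moving the runners of an abacus\<close>

definition runner_end :: "int \<Rightarrow> (int \<Rightarrow> int) \<Rightarrow> int \<Rightarrow> int" where
  "runner_end t n i = t * n i + i"

text \<open>Runner \<open>i\<close> becomes runner \<open>\<sigma> i\<close>, and its beads keep their positions relative to the end of
  their runner.\<close>
definition runner_map :: "int \<Rightarrow> (int \<Rightarrow> int) \<Rightarrow> (int \<Rightarrow> int) \<Rightarrow> (int \<Rightarrow> int) \<Rightarrow> int \<Rightarrow> int" where
  "runner_map t n n' \<sigma> x = x - runner_end t n (x mod t) + runner_end t n' (\<sigma> (x mod t))"

locale runner_permutation =
  fixes t :: int and n n' \<sigma> :: "int \<Rightarrow> int"
  assumes pos: "t > 0" and perm: "bij_betw \<sigma> {0..<t} {0..<t}"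
begin

abbreviation \<phi> :: "int \<Rightarrow> int" where
  "\<phi> \<equiv> runner_map t n n' \<sigma>"

lemma runner_map_mod: "\<phi> x mod t = \<sigma> (x mod t)"
proof -
  have "x mod t \<in> {0..<t}" using pos by simp
  hence "\<sigma> (x mod t) \<in> {0..<t}" using perm by (rule bij_betwE[THEN bspec, rotated])
  moreover have "\<phi> x = \<sigma> (x mod t) + t * (x div t + n' (\<sigma> (x mod t)) - n (x mod t))"
    using div_mult_mod_eq[of x t] by (simp add: runner_map_def runner_end_def algebra_simps)
  ultimately show ?thesis by (simp only: mod_mult_self2) simp
qed

lemma runner_map_eq_runner_end:
  assumes "i \<in> {0..<t}"
  shows "\<phi> i = runner_end t n' (\<sigma> i) - t * n i"
  using assms by (simp add: runner_map_def runner_end_def)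

lemma bij_runner_map: "bij \<phi>"
proof (rule bijI)
  show "inj \<phi>"
  proof (rule injI)
    fix x y assume eq: "\<phi> x = \<phi> y"
    hence "\<sigma> (x mod t) = \<sigma> (y mod t)" by (metis runner_map_mod)
    moreover have "x mod t \<in> {0..<t}" "y mod t \<in> {0..<t}" using pos by auto
    ultimately have "x mod t = y mod t" using perm by (metis bij_betw_def inj_onD)
    with eq show "x = y" by (simp add: runner_map_def)
  qed
  show "surj \<phi>"
    unfolding surj_def
  proof
    fix y
    have "y mod t \<in> \<sigma> ` {0..<t}" using perm pos by (simp add: bij_betw_def)
    then obtain i where i: "i \<in> {0..<t}" "\<sigma> i = y mod t" by force
    define x where "x = i + t * (n i - n' (\<sigma> i) + y div t)"
    have "x mod t = i" using i unfolding x_def mod_mult_self2 by simp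
    hence "y = \<phi> x"
      using i div_mult_mod_eq[of y t] by (simp add: runner_map_def runner_end_def x_def algebra_simps)
    thus "\<exists>x. y = \<phi> x" ..
  qed
qed

sublocale affine_permutation t \<phi>
  by unfold_locales (use pos bij_runner_map in \<open>auto simp: runner_map_def\<close>)

lemma charge_image_perm:
  assumes B: "commensurable B {..<0}" and i: "i \<in> {0..<t}"
  shows "charge t (\<phi> ` B) (\<sigma> i) = charge t B i + n' (\<sigma> i) - n i"
proof -
  define K :: "int \<Rightarrow> int" where "K = (\<lambda>x. of_bool (x mod t = \<sigma> i))"
  have \<sigma>i: "\<sigma> i \<in> {0..<t}" using perm i by (rule bij_betw_apply)
  have \<phi>_iff: "\<phi> x mod t = \<sigma> i \<longleftrightarrow> x mod t = i" for x
    using perm i pos unfolding runner_map_mod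
    by (metis Euclidean_Rings.pos_mod_bound Euclidean_Rings.pos_mod_sign atLeastLessThan_iff bij_betw_def inj_onD)
  have "t * excess K (\<phi> ` {..<0}) {..<0} = (\<Sum>j\<in>{0..<t}. \<phi> j * K (\<phi> j) - j * K j)"
    by (rule excess_image_negative) (simp add: K_def algebra_simps)
  also have "\<dots> = (\<Sum>j\<in>{0..<t}. (if j = i then \<phi> j else 0) - (if j = \<sigma> i then j else 0))"
    by (rule sum.cong) (auto simp: K_def \<phi>_iff)
  also have "\<dots> = \<phi> i - \<sigma> i" using i \<sigma>i by (simp add: sum_subtractf)
  also have "\<dots> = t * (n' (\<sigma> i) - n i)"
    by (simp add: runner_map_eq_runner_end[OF i] runner_end_def algebra_simps)
  finally have "excess K (\<phi> ` {..<0}) {..<0} = n' (\<sigma> i) - n i" using pos by simp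
  moreover have "charge t (\<phi> ` B) (\<sigma> i) = excess K (\<phi> ` B) {..<0}" "charge t B i = excess (K \<circ> \<phi>) B {..<0}"
    using i \<sigma>i by (simp_all add: charge_def K_def o_def \<phi>_iff)
  ultimately show ?thesis by (simp add: excess_image_eq_excess_comp[OF B])
qed

lemma charge_image:
  assumes "commensurable B {..<0}" "charge t B = n" and n': "\<And>i. n' (i mod t) = n' i"
  shows "charge t (\<phi> ` B) = n'"
proof
  fix j
  have "j mod t \<in> \<sigma> ` {0..<t}" using perm pos by (simp add: bij_betw_def)
  then obtain i where "i \<in> {0..<t}" "j mod t = \<sigma> i" by blast
  hence "charge t (\<phi> ` B) (j mod t) = n' (j mod t)"
    using charge_image_perm[OF assms(1)] assms(2) by simp
  thus "charge t (\<phi> ` B) j = n' j" by (simp add: n')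
qed

lemma sum_runner_end_perm: "(\<Sum>i\<in>{0..<t}. g (runner_end t n' (\<sigma> i))) = (\<Sum>i\<in>{0..<t}. g (runner_end t n' i))"
  using perm by (rule sum.reindex_bij_betw)

lemma energy_image:
  assumes B: "commensurable B {..<0}" and n: "charge t B = n"
  shows "2 * t * (energy (\<phi> ` B) - energy B) =
    (\<Sum>i\<in>{0..<t}. (runner_end t n' i)\<^sup>2 - t * runner_end t n' i) -
    (\<Sum>i\<in>{0..<t}. (runner_end t n i)\<^sup>2 - t * runner_end t n i)"
proof -
  have "excess \<phi> B {..<0} = excess (\<lambda>x. x + (\<phi> (x mod t) - x mod t)) B {..<0}"
    by (simp only: displacement_mod) simp
  also have "\<dots> = energy B + (\<Sum>i\<in>{0..<t}. (\<phi> i - i) * n i)"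
    unfolding excess_add energy_def excess_periodic[OF pos, of "\<lambda>i. \<phi> i - i"] n ..
  finally have image: "excess \<phi> B {..<0} = energy B + (\<Sum>i\<in>{0..<t}. (\<phi> i - i) * n i)" .
  have negative: "2 * t * excess (\<lambda>x. x) (\<phi> ` {..<0}) {..<0} =
      (\<Sum>i\<in>{0..<t}. ((\<phi> i)\<^sup>2 - t * \<phi> i) - (i\<^sup>2 - t * i))"
    by (rule excess_image_negative) (simp add: power2_eq_square algebra_simps)
  have "energy (\<phi> ` B) = excess \<phi> B {..<0} + excess (\<lambda>x. x) (\<phi> ` {..<0}) {..<0}"
    by (simp add: energy_def excess_image_eq_excess_comp[OF B] o_def)
  hence "2 * t * (energy (\<phi> ` B) - energy B) = 2 * t * (\<Sum>i\<in>{0..<t}. (\<phi> i - i) * n i) +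
      (\<Sum>i\<in>{0..<t}. ((\<phi> i)\<^sup>2 - t * \<phi> i) - (i\<^sup>2 - t * i))"
    by (simp add: image flip: negative) (simp add: algebra_simps)
  also have "\<dots> = (\<Sum>i\<in>{0..<t}. ((runner_end t n' (\<sigma> i))\<^sup>2 - t * runner_end t n' (\<sigma> i)) -
      ((runner_end t n i)\<^sup>2 - t * runner_end t n i))"
    unfolding sum_distrib_left sum.distrib[symmetric]
    by (rule sum.cong)
      (simp_all add: runner_map_eq_runner_end, simp add: runner_end_def power2_eq_square algebra_simps)
  finally show ?thesis
    using sum_runner_end_perm[of "\<lambda>e. e\<^sup>2 - t * e"] by (simp only: sum_subtractf)
qed

lemma sum_runner_end_eq:
  assumes "sum n' {0..<t} = sum n {0..<t}"
  shows "sum (runner_end t n') {0..<t} = sum (runner_end t n) {0..<t}"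
  using assms by (simp add: runner_end_def sum.distrib flip: sum_distrib_left)

lemma energy_image_eq:
  assumes "commensurable B {..<0}" "charge t B = n" and sum: "sum n' {0..<t} = sum n {0..<t}"
    and "(\<Sum>i\<in>{0..<t}. (runner_end t n' i)\<^sup>2) = (\<Sum>i\<in>{0..<t}. (runner_end t n i)\<^sup>2)"
  shows "energy (\<phi> ` B) = energy B"
proof -
  have "2 * t * (energy (\<phi> ` B) - energy B) = 0"
    unfolding energy_image[OF assms(1,2)] sum_subtractf sum_distrib_left[symmetric] sum_runner_end_eq[OF sum]
    by (simp add: assms(4))
  thus ?thesis using pos by simp
qed

lemma sum_displacement:
  assumes "sum n' {0..<t} = sum n {0..<t}"
  shows "(\<Sum>i\<in>{0..<t}. \<phi> i - i) = 0"
proof -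
  have "(\<Sum>i\<in>{0..<t}. \<phi> i - i) = (\<Sum>i\<in>{0..<t}. runner_end t n' (\<sigma> i) - runner_end t n i)"
    by (rule sum.cong) (simp_all add: runner_map_eq_runner_end, simp add: runner_end_def)
  thus ?thesis
    using sum_runner_end_perm[of "\<lambda>e. e"] sum_runner_end_eq[OF assms] by (simp add: sum_subtractf)
qed

end

lemma ex_bij_betw_matching:
  assumes A: "finite A" and card: "card {i\<in>A. P i} = card {i\<in>A. Q i}"
  shows "\<exists>\<sigma>. bij_betw \<sigma> A A \<and> (\<forall>i\<in>A. Q (\<sigma> i) \<longleftrightarrow> P i)"
proof -
  have "card A = card {i\<in>A. R i} + card {i\<in>A. \<not> R i}" for R
    using A by (subst card_Un_disjoint[symmetric]) (auto intro: arg_cong[where f = card])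
  from this[of P] this[of Q] card have "card {i\<in>A. \<not> P i} = card {i\<in>A. \<not> Q i}" by simp
  then obtain g where g: "bij_betw g {i\<in>A. \<not> P i} {i\<in>A. \<not> Q i}"
    using finite_same_card_bij[of "{i\<in>A. \<not> P i}" "{i\<in>A. \<not> Q i}"] A by auto
  obtain f where f: "bij_betw f {i\<in>A. P i} {i\<in>A. Q i}"
    using finite_same_card_bij[of "{i\<in>A. P i}" "{i\<in>A. Q i}"] A card by auto
  define \<sigma> where "\<sigma> = (\<lambda>i. if i \<in> {i\<in>A. P i} then f i else g i)"
  have "bij_betw \<sigma> ({i\<in>A. P i} \<union> {i\<in>A. \<not> P i}) ({i\<in>A. Q i} \<union> {i\<in>A. \<not> Q i})"
    unfolding \<sigma>_def by (rule bij_betw_disjoint_Un[OF f g]) auto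
  moreover have "{i\<in>A. R i} \<union> {i\<in>A. \<not> R i} = A" for R by auto
  moreover have "Q (\<sigma> i) \<longleftrightarrow> P i" if "i \<in> A" for i
    using bij_betw_apply[OF f, of i] bij_betw_apply[OF g, of i] that by (auto simp: \<sigma>_def)
  ultimately show ?thesis by auto
qed

definition parity_matching :: "int \<Rightarrow> (int \<Rightarrow> int) \<Rightarrow> (int \<Rightarrow> int) \<Rightarrow> int \<Rightarrow> int" where
  "parity_matching t n n' = (SOME \<sigma>. bij_betw \<sigma> {0..<t} {0..<t} \<and>
     (\<forall>i\<in>{0..<t}. odd (runner_end t n' (\<sigma> i)) \<longleftrightarrow> odd (runner_end t n i)))"

lemma
  assumes "card {i\<in>{0..<t}. odd (runner_end t n i)} = card {i\<in>{0..<t}. odd (runner_end t n' i)}"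
  shows bij_betw_parity_matching: "bij_betw (parity_matching t n n') {0..<t} {0..<t}"
    and odd_runner_end_parity_matching: "i \<in> {0..<t} \<Longrightarrow>
      odd (runner_end t n' (parity_matching t n n' i)) \<longleftrightarrow> odd (runner_end t n i)"
  using someI_ex[OF ex_bij_betw_matching[OF finite_atLeastLessThan_int assms]]
  unfolding parity_matching_def by blast+

subsection \<open>Rotating the 5-abacus\<close>

text \<open>In these coordinates of Garvan, Kim and Stanton, for \<open>a_0 + ... + a_4 = 1\<close>, the size of a 5-core is a
  quadratic form that is invariant under rotation of the \<open>a_i\<close>.\<close>
definition nvec_of :: "(int \<Rightarrow> int) \<Rightarrow> int \<Rightarrow> int" where
  "nvec_of a i = [a 0 + a 4, a 1 + a 4 - a 0, a 2 - a 1, a 3 - a 2 - a 4, - a 3 - a 4] ! nat (i mod 5)"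

text \<open>The inverse of \<open>nvec_of\<close>; the division is exact for the vectors satisfying \<open>admissible\<close> below.\<close>
definition coords :: "(int \<Rightarrow> int) \<Rightarrow> int \<Rightarrow> int" where
  "coords n i = (let e = (3 * n 0 + 2 * n 1 + n 2 - n 4 - 1) div 5 in
     [n 0 - e, n 0 + n 1 - 2 * e, n 0 + n 1 + n 2 - 2 * e, - n 4 - e, e] ! nat (i mod 5))"

definition rotate_nvec :: "(int \<Rightarrow> int) \<Rightarrow> int \<Rightarrow> int" where
  "rotate_nvec n = nvec_of (\<lambda>i. coords n (i - 1))"

definition admissible :: "(int \<Rightarrow> int) \<Rightarrow> bool" where
  "admissible n \<longleftrightarrow> (\<forall>i. n (i mod 5) = n i) \<and> (\<Sum>i\<in>{0..<5}. n i) = 0 \<and> (\<Sum>i\<in>{0..<5}. i * n i) mod 5 = 4"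

definition nvec_crank :: "(int \<Rightarrow> int) \<Rightarrow> int" where
  "nvec_crank n = 2 * (1 + n 0 - n 1 - n 2 + n 3) mod 5"

lemma atLeastLessThan_0_5: "{0..<5::int} = {0, 1, 2, 3, 4}"
  by auto

lemma ext_if_periodic:
  fixes f g :: "int \<Rightarrow> 'a"
  assumes "t > 0" "\<And>i. f (i mod t) = f i" "\<And>i. g (i mod t) = g i" "\<And>i. i \<in> {0..<t} \<Longrightarrow> f i = g i"
  shows "f = g"
proof
  fix i
  have "f (i mod t) = g (i mod t)" using assms(1) by (intro assms(4)) simp
  thus "f i = g i" by (simp only: assms(2,3))
qed

lemma nvec_of_simps:
  "nvec_of a 0 = a 0 + a 4" "nvec_of a 1 = a 1 + a 4 - a 0" "nvec_of a 2 = a 2 - a 1"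
  "nvec_of a 3 = a 3 - a 2 - a 4" "nvec_of a 4 = - a 3 - a 4" "nvec_of a (i mod 5) = nvec_of a i"
  by (simp_all add: nvec_of_def)

lemma coords_simps:
  "coords n 0 = n 0 - coords n 4" "coords n 1 = n 0 + n 1 - 2 * coords n 4"
  "coords n 2 = n 0 + n 1 + n 2 - 2 * coords n 4" "coords n 3 = - n 4 - coords n 4"
  "coords n (- 1) = coords n 4" "coords n (i mod 5) = coords n i"
  by (simp_all add: coords_def Let_def)

lemma coords_4: "coords n 4 = (3 * n 0 + 2 * n 1 + n 2 - n 4 - 1) div 5"
  by (simp add: coords_def Let_def)

lemma rotate_nvec_simps:
  "rotate_nvec n 0 = coords n 3 + coords n 4" "rotate_nvec n 1 = coords n 0 + coords n 3 - coords n 4"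
  "rotate_nvec n 2 = coords n 1 - coords n 0" "rotate_nvec n 3 = coords n 2 - coords n 1 - coords n 3"
  "rotate_nvec n 4 = - coords n 2 - coords n 3" "rotate_nvec n (i mod 5) = rotate_nvec n i"
  by (simp_all add: rotate_nvec_def nvec_of_simps coords_simps(5))

lemma coords_nvec_of:
  assumes "\<And>i. a (i mod 5) = a i" "a 0 + a 1 + a 2 + a 3 + a 4 = 1"
  shows "coords (nvec_of a) = a"
proof (rule ext_if_periodic[of 5])
  have "3 * nvec_of a 0 + 2 * nvec_of a 1 + nvec_of a 2 - nvec_of a 4 - 1 = 5 * a 4"
    using assms(2) by (simp add: nvec_of_simps)
  hence "coords (nvec_of a) 4 = a 4" by (simp add: coords_4)
  thus "coords (nvec_of a) i = a i" if "i \<in> {0..<5}" for i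
    using that unfolding atLeastLessThan_0_5 by (auto simp: coords_simps(1-4) nvec_of_simps)
qed (simp_all add: coords_simps(6) assms(1))

context
  fixes n :: "int \<Rightarrow> int"
  assumes n: "admissible n"
begin

lemma five_mult_coords_4: "5 * coords n 4 = 3 * n 0 + 2 * n 1 + n 2 - n 4 - 1"
proof -
  have sum: "n 0 + n 1 + n 2 + n 3 + n 4 = 0" and weighted: "(n 1 + 2 * n 2 + 3 * n 3 + 4 * n 4) mod 5 = 4"
    using n by (simp_all add: admissible_def atLeastLessThan_0_5 algebra_simps)
  have "5 dvd n 1 + 2 * n 2 + 3 * n 3 + 4 * n 4 + 1" using weighted by presburger
  moreover have "3 * n 0 + 2 * n 1 + n 2 - n 4 - 1 = - (n 1 + 2 * n 2 + 3 * n 3 + 4 * n 4 + 1)"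
    using sum by simp
  ultimately have "5 dvd 3 * n 0 + 2 * n 1 + n 2 - n 4 - 1" by (simp only: dvd_minus_iff)
  thus ?thesis by (simp add: coords_4)
qed

lemma sum_coords: "coords n 0 + coords n 1 + coords n 2 + coords n 3 + coords n 4 = 1"
  using five_mult_coords_4 by (simp add: coords_simps(1-4))

lemma nvec_of_coords: "nvec_of (coords n) = n"
proof (rule ext_if_periodic[of 5])
  have "n 0 + n 1 + n 2 + n 3 + n 4 = 0" using n by (simp add: admissible_def atLeastLessThan_0_5)
  thus "nvec_of (coords n) i = n i" if "i \<in> {0..<5}" for i
    using that unfolding atLeastLessThan_0_5 by (auto simp: nvec_of_simps coords_simps(1-4))
qed (use n in \<open>simp_all add: admissible_def nvec_of_simps(6)\<close>)

lemma coords_rotate_nvec: "coords (rotate_nvec n) = (\<lambda>i. coords n (i - 1))"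
  unfolding rotate_nvec_def
proof (rule coords_nvec_of)
  show "coords n (i mod 5 - 1) = coords n (i - 1)" for i
    by (metis coords_simps(6) mod_diff_left_eq)
  show "coords n (0 - 1) + coords n (1 - 1) + coords n (2 - 1) + coords n (3 - 1) + coords n (4 - 1) = 1"
    using sum_coords by (simp add: coords_simps(5))
qed

lemma sum_squares_rotate_nvec:
  "(\<Sum>i\<in>{0..<5}. (runner_end 5 (rotate_nvec n) i)\<^sup>2) = (\<Sum>i\<in>{0..<5}. (runner_end 5 n i)\<^sup>2)"
proof -
  define a where "a = coords n"
  have "a 0 = 1 - a 1 - a 2 - a 3 - a 4" using sum_coords by (simp add: a_def)
  hence "(\<Sum>i\<in>{0..<5}. (runner_end 5 (rotate_nvec n) i)\<^sup>2) = (\<Sum>i\<in>{0..<5}. (runner_end 5 (nvec_of a) i)\<^sup>2)"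
    by (simp add: atLeastLessThan_0_5 runner_end_def nvec_of_simps rotate_nvec_simps flip: a_def)
      (simp add: power2_eq_square algebra_simps)
  thus ?thesis by (simp add: a_def nvec_of_coords)
qed

lemma card_odd_rotate_nvec:
  "card {i\<in>{0..<5}. odd (runner_end 5 (rotate_nvec n) i)} = card {i\<in>{0..<5}. odd (runner_end 5 n i)}"
proof -
  define a where "a = coords n"
  have "odd (a 0 + a 1 + a 2 + a 3 + a 4)" using sum_coords by (simp add: a_def)
  hence "(\<Sum>i\<in>{0..<5}. of_bool (odd (runner_end 5 (rotate_nvec n) i)) :: nat) =
      (\<Sum>i\<in>{0..<5}. of_bool (odd (runner_end 5 (nvec_of a) i)))"
    by (cases "even (a 0)"; cases "even (a 1)"; cases "even (a 2)"; cases "even (a 3)"; cases "even (a 4)")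
      (simp_all add: atLeastLessThan_0_5 runner_end_def nvec_of_simps rotate_nvec_simps flip: a_def)
  thus ?thesis by (simp add: a_def nvec_of_coords of_bool_def sum.If_cases Int_def)
qed

lemma nvec_crank_rotate_nvec: "nvec_crank (rotate_nvec n) = (nvec_crank n + 1) mod 5"
proof -
  define a where "a = coords n"
  have "a 0 = 1 - a 1 - a 2 - a 3 - a 4" using sum_coords by (simp add: a_def)
  hence "2 * (1 + rotate_nvec n 0 - rotate_nvec n 1 - rotate_nvec n 2 + rotate_nvec n 3) =
      2 * (1 + nvec_of a 0 - nvec_of a 1 - nvec_of a 2 + nvec_of a 3) + 1 + 5 * (2 * (a 2 + a 4) - 1)"
    by (simp add: nvec_of_simps rotate_nvec_simps flip: a_def)
  hence "nvec_crank (rotate_nvec n) = (nvec_crank (nvec_of a) + 1) mod 5"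
    unfolding nvec_crank_def by (simp only: mod_mult_self2 mod_add_left_eq)
  thus ?thesis by (simp add: a_def nvec_of_coords)
qed

end

lemma sum_rotate_nvec: "(\<Sum>i\<in>{0..<5}. rotate_nvec n i) = 0"
  by (simp add: atLeastLessThan_0_5 rotate_nvec_simps)

lemma inj_on_rotate_nvec: "inj_on rotate_nvec {n. admissible n}"
proof (rule inj_onI)
  fix n m assume "n \<in> {n. admissible n}" "m \<in> {n. admissible n}" and eq: "rotate_nvec n = rotate_nvec m"
  hence n: "admissible n" and m: "admissible m" by simp_all
  have "(\<lambda>i. coords n (i - 1)) = (\<lambda>i. coords m (i - 1))"
    using coords_rotate_nvec[OF n] coords_rotate_nvec[OF m] eq by simp
  from fun_cong[OF this, of "_ + 1"] have "coords n i = coords m i" for i by simp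
  thus "n = m" using nvec_of_coords[OF n] nvec_of_coords[OF m] by (metis ext)
qed

definition rotate_runners :: "int set \<Rightarrow> int set" where
  "rotate_runners B = (let n = charge 5 B; n' = rotate_nvec n in runner_map 5 n n' (parity_matching 5 n n') ` B)"

lemma admissible_charge:
  assumes "balanced B" "energy B mod 5 = 4"
  shows "admissible (charge 5 B)"
  using assms excess_1_eq_sum_charge[of 5 B] energy_mod[of 5 B] by (simp add: admissible_def balanced_def)

lemma
  assumes B: "balanced B" and energy: "energy B mod 5 = 4"
  shows balanced_rotate_runners: "balanced (rotate_runners B)"
    and charge_rotate_runners: "charge 5 (rotate_runners B) = rotate_nvec (charge 5 B)"
    and energy_rotate_runners: "energy (rotate_runners B) = energy B"
    and charge_2_rotate_runners: "charge 2 (rotate_runners B) 0 = charge 2 B 0"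
proof -
  define n where "n = charge 5 B"
  define n' where "n' = rotate_nvec n"
  define \<sigma> where "\<sigma> = parity_matching 5 n n'"
  have n: "admissible n" using admissible_charge[OF B energy] by (simp add: n_def)
  note matching = card_odd_rotate_nvec[OF n, symmetric, folded n'_def]
  interpret runner_permutation 5 n n' \<sigma>
    by unfold_locales (simp_all add: \<sigma>_def bij_betw_parity_matching[OF matching])
  have rotate: "rotate_runners B = \<phi> ` B" by (simp add: rotate_runners_def n_def n'_def \<sigma>_def Let_def)
  have commensurable: "commensurable B {..<0}" using B by (simp add: balanced_def)
  have sum: "sum n' {0..<5} = sum n {0..<5}" using n by (simp add: n'_def sum_rotate_nvec admissible_def)
  show charge: "charge 5 (rotate_runners B) = rotate_nvec (charge 5 B)"
    unfolding rotate n_def[symmetric] n'_def[symmetric]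
    by (rule charge_image[OF commensurable]) (simp_all add: n_def n'_def rotate_nvec_simps)
  show "balanced (rotate_runners B)"
    using commensurable_image_if_commensurable[OF commensurable] excess_1_eq_sum_charge[of 5 "rotate_runners B"]
    by (simp add: balanced_def charge sum_rotate_nvec) (simp add: rotate)
  show "energy (rotate_runners B) = energy B"
    unfolding rotate using commensurable sum sum_squares_rotate_nvec[OF n]
    by (intro energy_image_eq) (simp_all add: n_def n'_def)
  have "even (\<phi> x - x)" for x
    using odd_runner_end_parity_matching[OF matching, of "x mod 5"] by (auto simp: runner_map_def \<sigma>_def)
  thus "charge 2 (rotate_runners B) 0 = charge 2 B 0"
    unfolding rotate by (intro charge_2_image[OF commensurable]) (simp_all add: sum_displacement[OF sum])
qed

lemma inj_on_rotate_runners: "inj_on rotate_runners {B. balanced B \<and> energy B mod 5 = 4}"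
proof (rule inj_onI; clarify)
  fix B C assume B: "balanced B" "energy B mod 5 = 4" and C: "balanced C" "energy C mod 5 = 4"
    and eq: "rotate_runners B = rotate_runners C"
  define n where "n = charge 5 B"
  have n: "admissible n" unfolding n_def using B by (rule admissible_charge)
  have "rotate_nvec (charge 5 B) = rotate_nvec (charge 5 C)"
    using charge_rotate_runners[OF B] charge_rotate_runners[OF C] eq by simp
  hence nC: "n = charge 5 C"
    using inj_on_rotate_nvec admissible_charge[OF B] admissible_charge[OF C] by (auto simp: n_def dest: inj_onD)
  interpret runner_permutation 5 n "rotate_nvec n" "parity_matching 5 n (rotate_nvec n)"
    by unfold_locales (simp_all add: bij_betw_parity_matching[OF card_odd_rotate_nvec[OF n, symmetric]])
  have "\<phi> ` B = \<phi> ` C" using eq by (simp add: rotate_runners_def Let_def flip: n_def nC)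
  thus "B = C" by (simp add: inj_image_eq_iff[OF inj])
qed

subsection \<open>Equidistribution of the crank\<close>

lemma srank_mod_4_eq_charge:
  "is_partition p \<Longrightarrow> srank p mod 4 = (energy (beads p) - charge 2 (beads p) 0) mod 4"
  by (simp add: srank_mod_4 nvec_eq_charge energy_beads)

lemma crank5_eq_nvec_crank: "is_partition p \<Longrightarrow> crank5 p = nvec_crank (charge 5 (beads p))"
  by (simp add: crank5_def nvec_crank_def nvec_core nvec_eq_charge)

definition rotate_partition :: "nat list \<Rightarrow> nat list" where
  "rotate_partition p = inv_into {p. is_partition p} beads (rotate_runners (beads p))"

lemma balanced_energy_beads:
  assumes "p \<in> partitions m" "m mod 5 = 4"
  shows "balanced (beads p)" "energy (beads p) mod 5 = 4"
proof -
  have p: "is_partition p" "sum_list p = m" using assms(1) by (simp_all add: partitions_def)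
  show "balanced (beads p)" using p(1) by (rule balanced_beads)
  have "int m mod 5 = int (m mod 5)" by (simp add: zmod_int)
  thus "energy (beads p) mod 5 = 4" by (simp add: energy_beads p assms(2))
qed

lemma
  assumes p: "p \<in> partitions m" and m: "m mod 5 = 4"
  shows rotate_partition_in_partitions: "rotate_partition p \<in> partitions m"
    and beads_rotate_partition: "beads (rotate_partition p) = rotate_runners (beads p)"
    and srank_rotate_partition: "srank (rotate_partition p) mod 4 = srank p mod 4"
    and crank5_rotate_partition: "crank5 (rotate_partition p) = (crank5 p + 1) mod 5"
proof -
  note B = balanced_energy_beads[OF p m]
  have partition: "is_partition p" and size: "sum_list p = m" using p by (simp_all add: partitions_def)
  have image: "rotate_runners (beads p) \<in> beads ` {p. is_partition p}"
    using balanced_rotate_runners[OF B] bij_betw_beads by (simp add: bij_betw_def)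
  show beads: "beads (rotate_partition p) = rotate_runners (beads p)"
    using f_inv_into_f[OF image] by (simp add: rotate_partition_def)
  have rotated: "is_partition (rotate_partition p)"
    using inv_into_into[OF image] by (simp add: rotate_partition_def)
  have "sum_list (rotate_partition p) = sum_list p"
    using energy_rotate_runners[OF B] energy_beads[OF partition] energy_beads[OF rotated] by (simp add: beads)
  thus "rotate_partition p \<in> partitions m" using rotated size by (simp add: partitions_def)
  show "srank (rotate_partition p) mod 4 = srank p mod 4"
    by (simp add: srank_mod_4_eq_charge partition rotated beads energy_rotate_runners[OF B]
        charge_2_rotate_runners[OF B])
  show "crank5 (rotate_partition p) = (crank5 p + 1) mod 5"
    by (simp add: crank5_eq_nvec_crank partition rotated beads charge_rotate_runners[OF B]
        nvec_crank_rotate_nvec[OF admissible_charge[OF B]])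
qed

lemma inj_on_rotate_partition:
  assumes m: "m mod 5 = 4"
  shows "inj_on rotate_partition (partitions m)"
proof (rule inj_onI)
  fix p q assume p: "p \<in> partitions m" and q: "q \<in> partitions m"
    and eq: "rotate_partition p = rotate_partition q"
  have "rotate_runners (beads p) = rotate_runners (beads q)"
    using beads_rotate_partition[OF p m] beads_rotate_partition[OF q m] eq by simp
  hence "beads p = beads q"
    by (rule inj_onD[OF inj_on_rotate_runners])
      (simp_all add: balanced_energy_beads[OF p m] balanced_energy_beads[OF q m])
  thus "p = q" using inj_on_beads p q by (auto simp: partitions_def dest: inj_onD)
qed

lemma finite_partitions: "finite (partitions m)"
proof -
  have "length p \<le> sum_list p" if "0 \<notin> set p" for p :: "nat list"
    using that by (induction p) auto
  hence "partitions m \<subseteq> {p. set p \<subseteq> {..m} \<and> length p \<le> m}"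
    by (auto simp: partitions_def is_partition_def member_le_sum_list)
  thus ?thesis using finite_lists_length_le[of "{..m}" m] finite_subset by blast
qed

lemma card_fibre_if_inj_cyclic_shift:
  fixes f :: "'a \<Rightarrow> int"
  assumes A: "finite A" and inj: "inj_on F A" and F: "F ` A \<subseteq> A"
    and shift: "\<And>x. x \<in> A \<Longrightarrow> f (F x) = (f x + 1) mod t"
    and range: "f ` A \<subseteq> {0..<t}" and j: "j \<in> {0..<t}"
  shows "nat t * card {x \<in> A. f x = j} = card A"
proof -
  define N where "N = (\<lambda>k. card {x \<in> A. f x = k mod t})"
  have step: "N k \<le> N (k + 1)" for k
    unfolding N_def
  proof (rule card_inj_on_le)
    show "inj_on F {x \<in> A. f x = k mod t}" by (rule inj_on_subset[OF inj]) auto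
    show "F ` {x \<in> A. f x = k mod t} \<subseteq> {x \<in> A. f x = (k + 1) mod t}"
      using F shift by (auto simp: mod_add_left_eq)
  qed (use A in simp)
  have "N k \<le> N (k + int i)" for k i
  proof (induction i)
    case (Suc i)
    also have "N (k + int i) \<le> N (k + int (Suc i))" using step[of "k + int i"] by (simp add: ac_simps)
    finally show ?case .
  qed simp
  hence N_le: "N k \<le> N l" if "k \<le> l" for k l using that by (metis zle_iff_zadd)
  have fibre: "card {x \<in> A. f x = k} = card {x \<in> A. f x = j}" if "k \<in> {0..<t}" for k
    using N_le[of k "j + t"] N_le[of j "k + t"] that j by (simp add: N_def)
  have "card A = card (\<Union>k\<in>{0..<t}. {x \<in> A. f x = k})"
    using range by (intro arg_cong[where f = card]) auto
  also have "\<dots> = (\<Sum>k\<in>{0..<t}. card {x \<in> A. f x = k})"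
    using A by (intro card_UN_disjoint) auto
  also have "\<dots> = (\<Sum>k\<in>{0..<t}. card {x \<in> A. f x = j})" by (rule sum.cong[OF refl fibre])
  finally show ?thesis by simp
qed

theorem theorem3:
  fixes n :: nat and i j :: int
  assumes "i \<in> {0, 2}" and "j \<in> {0, 1, 2, 3, 4}"
  shows "real (card {p \<in> partitions (5 * n + 4). srank p mod 4 = i \<and> crank5 p = j})
           = real (p_srank i (5 * n + 4)) / 5"
proof -
  define A where "A = {p \<in> partitions (5 * n + 4). srank p mod 4 = i}"
  have size: "(5 * n + 4) mod 5 = 4" by simp
  have "nat 5 * card {p \<in> A. crank5 p = j} = card A"
  proof (rule card_fibre_if_inj_cyclic_shift)
    show "finite A" using finite_partitions by (simp add: A_def)
    show "inj_on rotate_partition A"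
      by (rule inj_on_subset[OF inj_on_rotate_partition[OF size]]) (auto simp: A_def)
    show "rotate_partition ` A \<subseteq> A"
      using rotate_partition_in_partitions[OF _ size] srank_rotate_partition[OF _ size] by (auto simp: A_def)
    show "crank5 (rotate_partition p) = (crank5 p + 1) mod 5" if "p \<in> A" for p
      using crank5_rotate_partition[OF _ size] that by (simp add: A_def)
    show "crank5 ` A \<subseteq> {0..<5}" by (auto simp: crank5_def Let_def)
    show "j \<in> {0..<5}" using assms(2) by auto
  qed
  moreover have "{p \<in> A. crank5 p = j} = {p \<in> partitions (5 * n + 4). srank p mod 4 = i \<and> crank5 p = j}"
    by (auto simp: A_def)
  ultimately show ?thesis by (simp add: p_srank_def A_def)
qed

end
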